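(* Let $w=(w_k)_{k\ge0}$ be a weight sequence with $w_0>0$ and $w_k>0$ for some $k\ge1$. Suppose that $n\to\infty$ and $m=m(n)$ with $m/n\to\lambda$, where $0\le\lambda<\omega$, and let $\tau$ be the unique number in $[0,\rho]$ with $\Psi(\tau)=\lambda$ if $\lambda\le\nu$, and $\tau=\rho$ if $\lambda>\nu$. Then $$\frac{Z(m,n+1)}{Z(m,n)}\to\Phi(\tau).$$
   Context: A weight sequence is a sequence $w=(w_k)_{k\ge0}$ of nonnegative reals; $\omega=\sup\{k:w_k>0\}$. $\Phi(t)=\sum_kw_kt^k$, $\rho$ its radius of convergence; $\Psi(t)=t\Phi'(t)/\Phi(t)$ for $\Phi(t)<\infty$, $\Psi(\rho)=\lim_{t\uparrow\rho}\Psi(t)$ if $\Phi(\rho)=\infty$; $\nu=\Psi(\rho)$. $Z(m,n)=\sum\prod_{i=1}^nw_{y_i}$ over all $(y_1,\dots,y_n)\in\{0,1,\dots\}^n$ with $\sum y_i=m$; the limit is along $n$ with $Z(m,n)>0$. *)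

theory Defs
  imports "HOL-Analysis.Analysis"
begin

text \<open>Weight sequences w :: nat => real (nonnegativity is a hypothesis of the theorem).\<close>

definition omega :: "(nat \<Rightarrow> real) \<Rightarrow> ereal" where
  "omega w = Sup ((\<lambda>k. ereal (real k)) ` {k. 0 < w k})"

definition Phi :: "(nat \<Rightarrow> real) \<Rightarrow> real \<Rightarrow> ereal" where
  "Phi w t = (\<Sum>k. ereal (w k * t ^ k))"

definition Phi' :: "(nat \<Rightarrow> real) \<Rightarrow> real \<Rightarrow> ereal" where
  "Phi' w t = (\<Sum>k. ereal (real k * w k * t ^ (k - 1)))"

definition rho :: "(nat \<Rightarrow> real) \<Rightarrow> ereal" where
  "rho w = conv_radius w"

definition PhiE :: "(nat \<Rightarrow> real) \<Rightarrow> ereal \<Rightarrow> ereal" where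
  "PhiE w t = (if t = \<infinity> then \<infinity> else Phi w (real_of_ereal t))"

definition Psi :: "(nat \<Rightarrow> real) \<Rightarrow> real \<Rightarrow> ereal" where
  "Psi w t = ereal t * Phi' w t / Phi w t"

definition PsiE :: "(nat \<Rightarrow> real) \<Rightarrow> ereal \<Rightarrow> ereal" where
  "PsiE w t = (if PhiE w t < \<infinity> then Psi w (real_of_ereal t)
               else if t = \<infinity> then Lim at_top (Psi w)
               else Lim (at_left (real_of_ereal t)) (Psi w))"

definition nu :: "(nat \<Rightarrow> real) \<Rightarrow> ereal" where
  "nu w = PsiE w (rho w)"

definition tau :: "(nat \<Rightarrow> real) \<Rightarrow> real \<Rightarrow> ereal" where
  "tau w l = (if ereal l \<le> nu w
              then (THE t. 0 \<le> t \<and> t \<le> rho w \<and> PsiE w t = ereal l)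
              else rho w)"

text \<open>Z(m,n) = sum over (y_1..y_n) in N^n with sum m of prod w_{y_i}.
  Tuples are represented as functions nat => nat vanishing outside {..<n}.\<close>
definition Z :: "(nat \<Rightarrow> real) \<Rightarrow> nat \<Rightarrow> nat \<Rightarrow> real" where
  "Z w m n = (\<Sum>y\<in>{y :: nat \<Rightarrow> nat. (\<forall>i\<ge>n. y i = 0) \<and> (\<Sum>i<n. y i) = m}.
                 \<Prod>i<n. w (y i))"

end

theory Submission
  imports Defs "HOL-Computational_Algebra.Polynomial_FPS" "HOL-Real_Asymp.Real_Asymp"
begin

text \<open>
  Write \<open>r\<^sub>n = w\<^sub>0 Z(m,n-1) / Z(m,n)\<close> for the mean proportion of empty boxes. Applying
  \<open>(E X)\<^sup>2 \<le> E X\<^sup>2\<close> to the number \<open>X\<close> of empty boxes gives \<open>(n+1) r\<^sub>n\<^sub>+\<^sub>1 \<le> n r\<^sub>n + 1\<close>, so \<open>r\<close> changes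
  by at most about \<open>\<delta>\<close> over \<open>\<delta>n\<close> steps. Hence exponential bounds on \<open>Z(m,N)\<close> for \<open>N\<close> near \<open>n\<close>
  determine the limit of \<open>r\<^sub>n\<close>.

  The number \<open>\<tau>\<close> minimises \<open>\<Phi>(t) t\<^sup>-\<^sup>\<lambda>\<close>. The upper bound \<open>Z(m,N) \<tau>\<^sup>m \<le> \<Phi>(\<tau>)\<^sup>N\<close> is trivial. For the
  matching lower bound up to a factor \<open>exp (o(n))\<close>, truncate \<open>w\<close> (this changes the minimum very little,
  by compactness), find by a Chernoff bound at the minimiser some \<open>M\<close> close to \<open>m\<close> with \<open>Z(M,n')\<close>
  large, where \<open>n' = n - \<delta>n\<close>, and use the remaining \<open>\<delta>n\<close> boxes to move from \<open>M\<close> to \<open>m\<close>.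

  If \<open>\<lambda> = 0\<close> or \<open>\<rho> = 0\<close> the limit is \<open>w\<^sub>0\<close>: every fixed positive box size then has vanishing frequency, for
  \<open>\<rho> = 0\<close> because \<open>K\<close> boxes of size \<open>j\<close> are beaten by \<open>j\<close> boxes of size \<open>K\<close> and \<open>K - j\<close> empty ones.
\<close>

section \<open>Partition functions as power series coefficients\<close>

text \<open>Removing the last coordinate of a tuple gives the convolution recursion for powers of
  the generating series, so facts about \<open>Z\<close> become algebra of coefficients.\<close>

lemma Z_eq_fps_power_nth: "Z w m n = fps_nth (Abs_fps w ^ n) m"
proof -
  define Y where "Y = (\<lambda>n m. {y :: nat \<Rightarrow> nat. (\<forall>i\<ge>n. y i = 0) \<and> (\<Sum>i<n. y i) = m})"
  have Y_Suc: "Y (Suc n) m = (\<lambda>(k, y). y(n := k)) ` (SIGMA k:{0..m}. Y n (m - k))" for n m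
  proof (intro equalityI subsetI)
    fix y assume y: "y \<in> Y (Suc n) m"
    have "(\<Sum>i<n. (y(n := 0)) i) = (\<Sum>i<n. y i)"
      by (intro sum.cong) auto
    with y have "(y n, y(n := 0)) \<in> (SIGMA k:{0..m}. Y n (m - k))"
      by (auto simp: Y_def Suc_le_eq)
    then show "y \<in> (\<lambda>(k, y). y(n := k)) ` (SIGMA k:{0..m}. Y n (m - k))"
      by (rule rev_image_eqI) auto
  next
    fix y assume "y \<in> (\<lambda>(k, y). y(n := k)) ` (SIGMA k:{0..m}. Y n (m - k))"
    then obtain k x where kx: "k \<le> m" "x \<in> Y n (m - k)" "y = x(n := k)" by auto
    have "(\<Sum>i<n. (x(n := k)) i) = (\<Sum>i<n. x i)"
      by (intro sum.cong) auto
    with kx show "y \<in> Y (Suc n) m" by (auto simp: Y_def)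
  qed
  have fin: "finite (Y n m)" for n m
  proof (induction n arbitrary: m)
    case 0
    have "Y 0 m \<subseteq> {\<lambda>_. 0}" by (auto simp: Y_def)
    then show ?case by (rule finite_subset) simp
  next
    case (Suc n)
    then show ?case by (simp add: Y_Suc)
  qed
  have "(\<Sum>y\<in>Y n m. \<Prod>i<n. w (y i)) = fps_nth (Abs_fps w ^ n) m"
  proof (induction n arbitrary: m)
    case 0
    have "Y 0 m = (if m = 0 then {\<lambda>_. 0} else {})" by (auto simp: Y_def)
    then show ?case by simp
  next
    case (Suc n)
    \<comment> \<open>Tuples in \<open>Y n\<close> vanish at position \<open>n\<close>, so the
      update there destroys no information.\<close>
    have inj: "inj_on (\<lambda>(k, y). y(n := k)) (SIGMA k:{0..m}. Y n (m - k))"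
    proof (rule inj_onI, clarify)
      fix k x k' x'
      assume *: "x \<in> Y n (m - k)" "x' \<in> Y n (m - k')" "x(n := k) = x'(n := k')"
      have "k = k'" using fun_cong[OF *(3), of n] by simp
      moreover have "x i = x' i" for i
        using fun_cong[OF *(3), of i] *(1,2) by (cases "i = n") (auto simp: Y_def)
      ultimately show "k = k' \<and> x = x'" by auto
    qed
    have "(\<Sum>y\<in>Y (Suc n) m. \<Prod>i<Suc n. w (y i))
        = (\<Sum>(k, y)\<in>(SIGMA k:{0..m}. Y n (m - k)). \<Prod>i<Suc n. w ((y(n := k)) i))"
      unfolding Y_Suc by (subst sum.reindex[OF inj]) (simp add: case_prod_unfold)
    also have "\<dots> = (\<Sum>k=0..m. \<Sum>y\<in>Y n (m - k). \<Prod>i<Suc n. w ((y(n := k)) i))"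
      using fin by (subst sum.Sigma) auto
    also have "\<dots> = (\<Sum>k=0..m. w k * fps_nth (Abs_fps w ^ n) (m - k))"
    proof (rule sum.cong[OF refl])
      fix k
      have "(\<Sum>y\<in>Y n (m - k). \<Prod>i<Suc n. w ((y(n := k)) i))
          = (\<Sum>y\<in>Y n (m - k). w k * (\<Prod>i<n. w (y i)))"
        by (intro sum.cong) (auto simp: mult.commute)
      then show "(\<Sum>y\<in>Y n (m - k). \<Prod>i<Suc n. w ((y(n := k)) i))
          = w k * fps_nth (Abs_fps w ^ n) (m - k)"
        by (simp add: Suc.IH flip: sum_distrib_left)
    qed
    also have "\<dots> = fps_nth (Abs_fps w ^ Suc n) m"
      by (simp add: fps_mult_nth)
    finally show ?case .
  qed
  then show ?thesis by (simp add: Z_def Y_def)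
qed

lemma Z_0 [simp]: "Z w m 0 = (if m = 0 then 1 else 0)"
  by (simp add: Z_eq_fps_power_nth)

lemma Z_Suc: "Z w m (Suc n) = (\<Sum>k\<le>m. w k * Z w (m - k) n)"
  by (simp add: Z_eq_fps_power_nth fps_mult_nth atMost_atLeast0)

lemma fps_mult_nonneg:
  fixes a b :: "real fps"
  shows "(\<And>k. 0 \<le> fps_nth a k) \<Longrightarrow> (\<And>k. 0 \<le> fps_nth b k) \<Longrightarrow> 0 \<le> fps_nth (a * b) k"
  by (simp add: fps_mult_nth sum_nonneg)

lemma fps_power_nonneg:
  fixes a :: "real fps"
  assumes "\<And>k. 0 \<le> fps_nth a k"
  shows "0 \<le> fps_nth (a ^ n) k"
  by (induction n arbitrary: k) (auto intro: fps_mult_nonneg assms)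

lemma Z_nonneg: "(\<And>k. 0 \<le> w k) \<Longrightarrow> 0 \<le> Z w m n"
  by (simp add: Z_eq_fps_power_nth fps_power_nonneg)

text \<open>Only one term of the convolution for the power \<open>n + n'\<close> is kept: the first
  \<open>n\<close> boxes hold \<open>m\<close> balls in total.\<close>

lemma Z_add_ge:
  assumes "\<And>k. 0 \<le> w k"
  shows "Z w m n * Z w m' n' \<le> Z w (m + m') (n + n')"
proof -
  have "Z w (m + m') (n + n') = (\<Sum>i=0..m + m'. Z w i n * Z w (m + m' - i) n')"
    by (simp add: Z_eq_fps_power_nth power_add fps_mult_nth)
  also have "\<dots> \<ge> (\<Sum>i\<in>{m}. Z w i n * Z w (m + m' - i) n')"
    by (intro sum_mono2) (auto intro!: mult_nonneg_nonneg Z_nonneg assms)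
  finally show ?thesis by simp
qed

lemma Z_mult_ge:
  assumes "\<And>k. 0 \<le> w k"
  shows "Z w m n ^ q \<le> Z w (q * m) (q * n)"
proof (induction q)
  case (Suc q)
  have "Z w m n ^ Suc q \<le> Z w m n * Z w (q * m) (q * n)"
    using Suc by (simp add: mult_left_mono Z_nonneg assms)
  also have "\<dots> \<le> Z w (Suc q * m) (Suc q * n)"
    using Z_add_ge[of w m n "q * m" "q * n"] assms by simp
  finally show ?case .
qed simp

lemma Z_single: "Z w k 1 = w k"
  by (simp add: Z_eq_fps_power_nth)

lemma Z_Suc_ge:
  assumes "\<And>k. 0 \<le> w k"
  shows "w 0 * Z w m n \<le> Z w m (Suc n)"
  using Z_add_ge[of w 0 1 m n] assms by (simp only: Z_single) simp

lemma Z_mono: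
  assumes "\<And>k. 0 \<le> u k" "\<And>k. u k \<le> w k"
  shows "Z u m n \<le> Z w m n"
proof (induction n arbitrary: m)
  case (Suc n)
  have "\<And>k. 0 \<le> w k" using assms order_trans by blast
  then show ?case
    unfolding Z_Suc by (intro sum_mono mult_mono Suc assms Z_nonneg)
qed simp

text \<open>Exponential Markov bound: one coefficient of a nonnegative series, weighted by its power
  of \<open>t\<close>, is at most the value of the series.\<close>

lemma Z_power_le:
  assumes "\<And>k. 0 \<le> w k" "0 \<le> t" "summable (\<lambda>k. w k * t ^ k)"
  shows "Z w m n * t ^ m \<le> (\<Sum>k. w k * t ^ k) ^ n"
proof (induction n arbitrary: m)
  case (Suc n)
  have nn: "0 \<le> w k * t ^ k" for k using assms by simp
  have "Z w m (Suc n) * t ^ m = (\<Sum>k\<le>m. w k * t ^ k * (Z w (m - k) n * t ^ (m - k)))"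
    unfolding Z_Suc sum_distrib_right
    by (intro sum.cong refl) (simp flip: power_add)
  also have "\<dots> \<le> (\<Sum>k\<le>m. w k * t ^ k * (\<Sum>k. w k * t ^ k) ^ n)"
    by (intro sum_mono mult_left_mono Suc nn)
  also have "\<dots> = (\<Sum>k\<le>m. w k * t ^ k) * (\<Sum>k. w k * t ^ k) ^ n"
    by (simp add: sum_distrib_right)
  also have "\<dots> \<le> (\<Sum>k. w k * t ^ k) * (\<Sum>k. w k * t ^ k) ^ n"
    by (intro mult_right_mono sum_le_suminf assms zero_le_power suminf_nonneg) (auto intro: nn)
  finally show ?case by simp
qed simp

text \<open>Both sides are the coefficient of degree \<open>m\<close> of
  \<open>fps_X * fps_deriv (W ^ Suc n)\<close>, read off directly and by the chain rule.
  Probabilistically, by symmetry one of \<open>Suc n\<close> boxes has mean load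
  \<open>m / Suc n\<close>.\<close>

lemma Z_size_biased:
  "real m * Z w m (Suc n) = real (Suc n) * (\<Sum>k\<le>m. real k * w k * Z w (m - k) n)"
proof -
  let ?W = "Abs_fps w"
  have "real m * Z w m (Suc n) = fps_nth (fps_X * fps_deriv (?W ^ Suc n)) m"
    by (cases m) (simp_all add: Z_eq_fps_power_nth del: power_Suc)
  also have "fps_X * fps_deriv (?W ^ Suc n) = of_nat (Suc n) * ((fps_X * fps_deriv ?W) * ?W ^ n)"
    by (simp only: fps_deriv_power fps_of_nat diff_Suc_1 mult_ac)
  also have "fps_nth \<dots> m = real (Suc n) * fps_nth ((fps_X * fps_deriv ?W) * ?W ^ n) m"
    by (simp only: fps_of_nat[symmetric] fps_mult_left_const_nth)
  also have "fps_nth ((fps_X * fps_deriv ?W) * ?W ^ n) m = (\<Sum>k\<le>m. real k * w k * Z w (m - k) n)"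
  proof -
    have "fps_nth (fps_X * fps_deriv ?W) k = real k * w k" for k
      by (cases k) simp_all
    then show ?thesis
      by (simp only: fps_mult_nth atMost_atLeast0 Z_eq_fps_power_nth)
  qed
  finally show ?thesis .
qed

section \<open>First and second moments of a binomial count, with power series as weights\<close>

lemma binomial_sum_weighted:
  fixes a b :: "'a :: comm_ring_1"
  shows "(\<Sum>i\<le>Suc n. of_nat i * (of_nat (Suc n choose i) * (a ^ i * b ^ (Suc n - i))))
    = of_nat (Suc n) * (a * (a + b) ^ n)"
proof -
  have "(\<Sum>i\<le>Suc n. of_nat i * (of_nat (Suc n choose i) * (a ^ i * b ^ (Suc n - i))))
      = (\<Sum>i\<le>n. of_nat (Suc i * (Suc n choose Suc i)) * (a ^ Suc i * b ^ (n - i)))"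
    by (subst sum.atMost_Suc_shift) (simp add: algebra_simps)
  also have "\<dots> = (\<Sum>i\<le>n. of_nat (Suc n) * (a * (of_nat (n choose i) * a ^ i * b ^ (n - i))))"
  proof (rule sum.cong[OF refl])
    fix i
    have "Suc i * (Suc n choose Suc i) = Suc n * (n choose i)"
      using Suc_times_binomial_eq[of n i] by (simp only: mult.commute)
    then show "of_nat (Suc i * (Suc n choose Suc i)) * (a ^ Suc i * b ^ (n - i))
       = of_nat (Suc n) * (a * (of_nat (n choose i) * a ^ i * b ^ (n - i)))"
      by (simp only: of_nat_mult) (simp add: algebra_simps)
  qed
  also have "\<dots> = of_nat (Suc n) * (a * (a + b) ^ n)"
    by (simp only: binomial_ring sum_distrib_left)
  finally show ?thesis .
qed

text \<open>Absorbing one factor \<open>i\<close> into the binomial coefficient reduces the claim to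
  the first-moment identity and the binomial theorem. The ring is arbitrary so that \<open>a\<close>
  and \<open>b\<close> can be power series.\<close>

lemma binomial_sum_weighted2:
  fixes a b :: "'a :: comm_ring_1"
  shows "(\<Sum>i\<le>Suc (Suc n). of_nat i * of_nat i *
      (of_nat (Suc (Suc n) choose i) * (a ^ i * b ^ (Suc (Suc n) - i))))
    = of_nat (Suc (Suc n)) * (of_nat (Suc n) * (a ^ 2 * (a + b) ^ n) + a * (a + b) ^ Suc n)"
proof -
  have "(\<Sum>i\<le>Suc (Suc n). of_nat i * of_nat i *
      (of_nat (Suc (Suc n) choose i) * (a ^ i * b ^ (Suc (Suc n) - i))))
      = (\<Sum>i\<le>Suc n. of_nat (Suc i) * (of_nat (Suc i * (Suc (Suc n) choose Suc i))
          * (a ^ Suc i * b ^ (Suc n - i))))"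
    by (subst sum.atMost_Suc_shift) (simp add: algebra_simps)
  also have "\<dots> = (\<Sum>i\<le>Suc n. of_nat (Suc (Suc n)) * (a * (of_nat i *
      (of_nat (Suc n choose i) * (a ^ i * b ^ (Suc n - i))) +
      of_nat (Suc n choose i) * a ^ i * b ^ (Suc n - i))))"
  proof (rule sum.cong[OF refl])
    fix i
    have "Suc i * (Suc (Suc n) choose Suc i) = Suc (Suc n) * (Suc n choose i)"
      using Suc_times_binomial_eq[of "Suc n" i] by (simp only: mult.commute)
    then show "of_nat (Suc i) * (of_nat (Suc i * (Suc (Suc n) choose Suc i))
          * (a ^ Suc i * b ^ (Suc n - i))) = of_nat (Suc (Suc n)) * (a * (of_nat i *
      (of_nat (Suc n choose i) * (a ^ i * b ^ (Suc n - i))) +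
      of_nat (Suc n choose i) * a ^ i * b ^ (Suc n - i)))"
      by (simp only: of_nat_mult) (simp add: algebra_simps)
  qed
  also have "\<dots> = of_nat (Suc (Suc n)) * (a *
      ((\<Sum>i\<le>Suc n. of_nat i * (of_nat (Suc n choose i) * (a ^ i * b ^ (Suc n - i)))) +
      (\<Sum>i\<le>Suc n. of_nat (Suc n choose i) * a ^ i * b ^ (Suc n - i))))"
    by (simp only: sum_distrib_left[symmetric] sum.distrib)
  also have "\<dots> = of_nat (Suc (Suc n)) * (a * (of_nat (Suc n) * (a * (a + b) ^ n) + (a + b) ^ Suc n))"
    by (simp only: binomial_sum_weighted binomial_ring)
  finally show ?thesis by (simp only: power2_eq_square algebra_simps)
qed

lemma weighted_sum_Cauchy_Schwarz:
  fixes q f :: "'a \<Rightarrow> real"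
  assumes "\<And>i. i \<in> A \<Longrightarrow> 0 \<le> q i"
  shows "(\<Sum>i\<in>A. f i * q i)\<^sup>2 \<le> (\<Sum>i\<in>A. q i) * (\<Sum>i\<in>A. f i * f i * q i)"
proof -
  have "(\<Sum>i\<in>A. f i * q i) = (\<Sum>i\<in>A. sqrt (q i) * (f i * sqrt (q i)))"
    using assms by (intro sum.cong) auto
  moreover have "(\<Sum>i\<in>A. q i) = (\<Sum>i\<in>A. (sqrt (q i))\<^sup>2)"
    using assms by (intro sum.cong) auto
  moreover have "(\<Sum>i\<in>A. f i * f i * q i) = (\<Sum>i\<in>A. (f i * sqrt (q i))\<^sup>2)"
    using assms by (intro sum.cong) (auto simp: power_mult_distrib power2_eq_square)
  ultimately show ?thesis
    using Cauchy_Schwarz_ineq_sum[of "\<lambda>i. sqrt (q i)" "\<lambda>i. f i * sqrt (q i)" A] by simp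
qed

text \<open>Jensen's inequality \<open>(E X)\<^sup>2 \<le> E X\<^sup>2\<close> for the number \<open>X\<close> of factors contributing \<open>a\<close>.\<close>
lemma fps_power_second_moment:
  fixes U a c :: "real fps"
  assumes nn: "\<And>k. 0 \<le> fps_nth U k" "\<And>k. 0 \<le> fps_nth a k" "\<And>k. 0 \<le> fps_nth c k"
  shows "real (Suc (Suc n)) * (fps_nth (U * (a * (a + c) ^ Suc n)) m)\<^sup>2
    \<le> (real (Suc n) * fps_nth (U * (a\<^sup>2 * (a + c) ^ n)) m + fps_nth (U * (a * (a + c) ^ Suc n)) m)
       * fps_nth (U * (a + c) ^ Suc (Suc n)) m"
proof -
  define N where "N = Suc (Suc n)"
  \<comment> \<open>\<open>q i\<close> is the contribution in which exactly \<open>i\<close> of the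
    \<open>N\<close> factors supply \<open>a\<close>; the three sums below are its moments of order
    0, 1 and 2.\<close>
  define q where "q = (\<lambda>i. real (N choose i) * fps_nth (U * (a ^ i * c ^ (N - i))) m)"
  have q_nn: "0 \<le> q i" for i
    unfolding q_def
    by (intro mult_nonneg_nonneg of_nat_0_le_iff fps_mult_nonneg fps_power_nonneg nn)
  have cq: "fps_nth (U * (of_nat x * Y)) m = real x * fps_nth (U * Y) m" for x Y
    by (simp add: fps_of_nat[symmetric] mult.left_commute[of U])
  have cq': "fps_nth (U * (of_nat i * of_nat i * Y)) m = real i * real i * fps_nth (U * Y) m" for i Y
    using cq[of "i * i" Y] by simp
  have nthsum: "fps_nth (U * (\<Sum>i\<le>N. f i)) m = (\<Sum>i\<le>N. fps_nth (U * f i) m)" for f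
    by (simp only: sum_distrib_left fps_sum_nth)
  have S0: "(\<Sum>i\<le>N. q i) = fps_nth (U * (a + c) ^ N) m"
    unfolding binomial_ring[of a c N] nthsum q_def
    by (intro sum.cong refl) (simp only: cq mult.assoc)
  have "fps_nth (U * (of_nat N * (a * (a + c) ^ Suc n))) m = (\<Sum>i\<le>N. real i * q i)"
    unfolding N_def binomial_sum_weighted[symmetric]
    unfolding N_def[symmetric] nthsum q_def cq ..
  then have S1: "(\<Sum>i\<le>N. real i * q i) = real N * fps_nth (U * (a * (a + c) ^ Suc n)) m"
    by (simp only: cq)
  have "fps_nth (U * (of_nat N * (of_nat (Suc n) * (a ^ 2 * (a + c) ^ n) + a * (a + c) ^ Suc n))) m
      = (\<Sum>i\<le>N. real i * real i * q i)"
    unfolding N_def binomial_sum_weighted2[symmetric]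
    unfolding N_def[symmetric] nthsum q_def cq cq' ..
  then have S2: "(\<Sum>i\<le>N. real i * real i * q i) = real N * (real (Suc n) *
      fps_nth (U * (a\<^sup>2 * (a + c) ^ n)) m + fps_nth (U * (a * (a + c) ^ Suc n)) m)"
    by (simp only: cq distrib_left[of U] fps_add_nth)
  have "real N * (real N * (fps_nth (U * (a * (a + c) ^ Suc n)) m)\<^sup>2) = (\<Sum>i\<le>N. real i * q i)\<^sup>2"
    by (simp only: S1 power2_eq_square mult_ac)
  also have "\<dots> \<le> (\<Sum>i\<le>N. q i) * (\<Sum>i\<le>N. real i * real i * q i)"
    by (rule weighted_sum_Cauchy_Schwarz) (rule q_nn)
  also have "\<dots> = real N * ((real (Suc n) * fps_nth (U * (a\<^sup>2 * (a + c) ^ n)) m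
      + fps_nth (U * (a * (a + c) ^ Suc n)) m) * fps_nth (U * (a + c) ^ N) m)"
    unfolding S0 S2 by (simp only: mult_ac)
  finally show ?thesis
    by (simp add: N_def del: of_nat_Suc power_Suc)
qed

text \<open>\<open>F i\<close> is the total weight when \<open>i\<close> prescribed factors supply
  \<open>a\<close>. Then \<open>(N - i) * F (Suc i) / F i\<close> is the expected number of further
  such factors, and by the second moment bound it drops by at most 1 when \<open>i\<close> grows by
  1. So each of the first \<open>L\<close> quotients \<open>F (Suc i) / F i\<close> is at least
  \<open>F 1 / F 0 - L / N\<close>, and they multiply to the claim.\<close>

lemma fps_power_ratio_down:
  fixes a c :: "real fps" and N m :: nat
  defines "F \<equiv> \<lambda>i. fps_nth (a ^ i * (a + c) ^ (N - i)) m"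
  assumes nn: "\<And>k. 0 \<le> fps_nth a k" "\<And>k. 0 \<le> fps_nth c k"
    and F0: "0 < F 0" and L: "L \<le> N" "real L / real N \<le> F 1 / F 0"
  shows "(F 1 / F 0 - real L / real N) ^ L * F 0 \<le> F L"
proof -
  define s where "s = F 1 / F 0"
  have sN: "real L \<le> real N * s" if "N > 0"
    using L(2) that by (simp add: s_def field_simps)
  have F_nn: "0 \<le> F i" for i
    unfolding F_def by (intro fps_mult_nonneg fps_power_nonneg) (auto simp: nn)
  have step: "real (N - i) * (F (Suc i))\<^sup>2 \<le> (real (N - Suc i) * F (Suc (Suc i)) + F (Suc i)) * F i"
    if "Suc (Suc i) \<le> N" for i
  proof -
    define n where "n = N - Suc (Suc i)"
    have N: "N - i = Suc (Suc n)" "N - Suc i = Suc n" "N - Suc (Suc i) = n"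
      using that by (auto simp: n_def)
    show ?thesis
      using fps_power_second_moment[of "a ^ i" a c n m] nn
      unfolding F_def N by (simp add: fps_power_nonneg power2_eq_square mult_ac)
  qed
  \<comment> \<open>Positivity of \<open>F i\<close> is carried along because the step divides by
    it; it persists as long as \<open>i < L \<le> N * s\<close>.\<close>
  have ratio: "0 < F i \<and> (real N * s - real i) * F i \<le> real (N - i) * F (Suc i)" if "i < L" for i
    using that
  proof (induction i)
    case 0
    then show ?case using F0 by (simp add: s_def)
  next
    case (Suc i)
    have IH: "0 < F i" "(real N * s - real i) * F i \<le> real (N - i) * F (Suc i)"
      using Suc by auto
    have Ni: "real (N - i) = real N - real i" "real (N - Suc i) = real N - real i - 1" "real N - real i > 0"
      using Suc.prems L by auto
    have "real N * s - real i > 0" using sN Suc.prems L by linarith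
    then have "0 < (real N * s - real i) * F i" using IH by simp
    with IH(2) have "0 < real (N - i) * F (Suc i)" by linarith
    then have pos: "0 < F (Suc i)" using Ni by (simp add: zero_less_mult_iff)
    have "((real N * s - real i) * F (Suc i)) * F i \<le> real (N - i) * (F (Suc i))\<^sup>2"
      using mult_right_mono[OF IH(2), of "F (Suc i)"] pos by (simp add: power2_eq_square mult_ac)
    also have "\<dots> \<le> (real (N - Suc i) * F (Suc (Suc i)) + F (Suc i)) * F i"
      using Suc.prems L by (intro step) auto
    finally have "(real N * s - real i) * F (Suc i) \<le> real (N - Suc i) * F (Suc (Suc i)) + F (Suc i)"
      using IH(1) by simp
    then show ?case using pos by (simp add: algebra_simps)
  qed
  have "(s - real L / real N) ^ i * F 0 \<le> F i" if "i \<le> L" for i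
    using that
  proof (induction i)
    case (Suc i)
    have Ni: "real (N - i) = real N - real i" "0 < real (N - i)" "0 < real N"
      using Suc.prems L by auto
    have d: "0 \<le> s - real L / real N" using L(2) by (simp add: s_def)
    \<comment> \<open>Enlarging \<open>N - i\<close> to \<open>N\<close> and \<open>i\<close> to
      \<open>L\<close> makes the bound independent of \<open>i\<close>.\<close>
    have "real (N - i) * ((s - real L / real N) * F i) \<le> real N * ((s - real L / real N) * F i)"
      using d F_nn by (intro mult_right_mono mult_nonneg_nonneg) auto
    also have "\<dots> = (real N * s - real L) * F i" using Ni by (simp add: field_simps)
    also have "\<dots> \<le> (real N * s - real i) * F i"
      using Suc.prems F_nn by (intro mult_right_mono) auto
    also have "\<dots> \<le> real (N - i) * F (Suc i)" using ratio[of i] Suc.prems by simp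
    finally have *: "(s - real L / real N) * F i \<le> F (Suc i)"
      using Ni(2) mult_le_cancel_left_pos by blast
    have "(s - real L / real N) ^ Suc i * F 0 \<le> (s - real L / real N) * F i"
      using Suc d by (simp add: mult.assoc mult_left_mono)
    with * show ?case by linarith
  qed simp
  then show ?thesis by (simp add: s_def)
qed

section \<open>Ratios of partition functions when the number of boxes changes\<close>

lemma fps_const_X_power_mult_nth:
  fixes Y :: "real fps"
  shows "fps_nth ((fps_const x * fps_X ^ j) ^ i * Y) m = (if m < j * i then 0 else x ^ i * fps_nth Y (m - j * i))"
proof -
  have "(fps_const x * fps_X ^ j) ^ i * Y = fps_const (x ^ i) * (fps_X ^ (j * i) * Y)"
    by (simp add: power_mult_distrib fps_const_power power_mult mult.assoc)
  then show ?thesis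
    by (simp only: fps_mult_left_const_nth fps_X_power_mult_nth) simp
qed

lemma Abs_fps_split:
  fixes w :: "nat \<Rightarrow> real"
  shows "Abs_fps w = fps_const (w j) * fps_X ^ j + Abs_fps (w(j := 0))"
  by (rule fps_ext) (simp add: fps_X_power_nth)

text \<open>The series splits into \<open>w j\<close> times the \<open>j\<close>-th power of
  \<open>fps_X\<close> and the other box sizes, and \<open>s\<close> is the probability that a given
  box holds \<open>j\<close> balls. If \<open>s\<close> is not tiny, then removing \<open>L\<close>
  boxes with \<open>j\<close> balls each leaves a partition function that is still large.\<close>

lemma Z_ratio_down:
  assumes nn: "\<And>k. 0 \<le> w k" and pos: "0 < Z w m N" and L: "L \<le> N" "j * L \<le> m" "j \<le> m"
    and s: "s = w j * Z w (m - j) (N - 1) / Z w m N" "real L / real N \<le> s"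
  shows "(s - real L / real N) ^ L * Z w m N \<le> w j ^ L * Z w (m - j * L) (N - L)"
proof -
  define a where "a = fps_const (w j) * fps_X ^ j"
  define c where "c = Abs_fps (w(j := 0))"
  have nn_a: "0 \<le> fps_nth a k" for k by (simp add: a_def fps_X_power_nth nn)
  have nn_c: "0 \<le> fps_nth c k" for k by (simp add: c_def nn)
  have W: "a + c = Abs_fps w" unfolding a_def c_def by (rule Abs_fps_split[symmetric])
  have F: "fps_nth (a ^ i * (a + c) ^ (N - i)) m = (if m < j * i then 0 else w j ^ i * Z w (m - j * i) (N - i))" for i
    unfolding W unfolding a_def fps_const_X_power_mult_nth Z_eq_fps_power_nth ..
  show ?thesis
    using fps_power_ratio_down[of a c N m L, OF nn_a nn_c] pos L s unfolding F by simp
qed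

text \<open>Here \<open>a\<close> is the constant series \<open>w 0\<close>, so the counted factors
  are the empty boxes. Dividing by \<open>w 0 * Z w m (Suc n) * Z w m (Suc (Suc n))\<close>, when
  positive, gives the recursion for the mean proportion of empty boxes.\<close>

lemma Z_ratio_step:
  assumes nn: "\<And>k. 0 \<le> w k"
  shows "real (Suc (Suc n)) * (w 0 * Z w m (Suc n))\<^sup>2
    \<le> (real (Suc n) * ((w 0)\<^sup>2 * Z w m n) + w 0 * Z w m (Suc n)) * Z w m (Suc (Suc n))"
proof -
  have "fps_const (w 0) + Abs_fps (w(0 := 0)) = Abs_fps w"
    using Abs_fps_split[of w 0] by simp
  then show ?thesis
    using fps_power_second_moment[of 1 "fps_const (w 0)" "Abs_fps (w(0 := 0))" n m] nn
    by (simp add: Z_eq_fps_power_nth fps_const_power del: power_Suc of_nat_Suc)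
qed

lemma Z_pos_add:
  assumes "\<And>k. 0 \<le> w k" "0 < w 0" "0 < Z w m n"
  shows "0 < Z w m (n + i)"
proof (induction i)
  case (Suc i)
  then have "0 < w 0 * Z w m (n + i)" using assms by simp
  also have "\<dots> \<le> Z w m (Suc (n + i))" by (rule Z_Suc_ge[OF assms(1)])
  finally show ?case by simp
qed (use assms in simp)

text \<open>The recursion is iterated \<open>i\<close> times; the resulting weight
  \<open>Suc n + i\<close> on the left is then lowered to \<open>Suc n\<close>.\<close>

lemma Z_ratio_up_le:
  assumes nn: "\<And>k. 0 \<le> w k" and w0: "0 < w 0" and pos: "0 < Z w m n"
  shows "w 0 * Z w m (n + i) / Z w m (Suc (n + i))
      \<le> w 0 * Z w m n / Z w m (Suc n) + real i / real (Suc n)"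
proof -
  define r where "r = (\<lambda>i. w 0 * Z w m (n + i) / Z w m (Suc (n + i)))"
  have Zp: "0 < Z w m (n + i)" "0 < Z w m (Suc (n + i))" for i
    using Z_pos_add[OF nn w0 pos, of i] Z_pos_add[OF nn w0 pos, of "Suc i"] by auto
  have r_nn: "0 \<le> r i" for i
    using Zp[of i] w0 by (simp add: r_def)
  have "(real (Suc n) + real i) * r i \<le> real (Suc n) * r 0 + real i" for i
  proof (induction i)
    case (Suc i)
    define A B C where "A = Z w m (n + i)" and "B = Z w m (Suc (n + i))" and "C = Z w m (Suc (Suc (n + i)))"
    have ABC: "0 < A" "0 < B" "0 < C"
      using Zp[of i] Zp[of "Suc i"] by (auto simp: A_def B_def C_def)
    have ri: "r i = w 0 * A / B" "r (Suc i) = w 0 * B / C"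
      by (auto simp: r_def A_def B_def C_def)
    define x where "x = real (Suc n) + real i"
    have "(x + 1) * (w 0 * B)\<^sup>2 \<le> (x * ((w 0)\<^sup>2 * A) + w 0 * B) * C"
      using Z_ratio_step[where w = w and n = "n + i" and m = m, OF nn] by (simp add: x_def A_def B_def C_def algebra_simps)
    moreover have "(x * ((w 0)\<^sup>2 * A) + w 0 * B) * C = (w 0 * B) * ((x * (w 0 * A / B) + 1) * C)"
      using ABC by (simp add: field_simps power2_eq_square)
    moreover have "(x + 1) * (w 0 * B)\<^sup>2 = (w 0 * B) * ((x + 1) * (w 0 * B))"
      by (simp add: power2_eq_square)
    ultimately have "(w 0 * B) * ((x + 1) * (w 0 * B)) \<le> (w 0 * B) * ((x * (w 0 * A / B) + 1) * C)"
      by simp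
    then have "(x + 1) * (w 0 * B) \<le> (x * (w 0 * A / B) + 1) * C"
      using ABC w0 mult_le_cancel_left_pos[of "w 0 * B"] by simp
    then have "(x + 1) * r (Suc i) \<le> x * r i + 1"
      using ABC by (simp add: ri field_simps)
    also have "\<dots> \<le> real (Suc n) * r 0 + real (Suc i)" using Suc.IH by (simp add: x_def)
    finally show ?case by (simp add: x_def algebra_simps)
  qed simp
  then have "(real (Suc n) + real i) * r i \<le> real (Suc n) * r 0 + real i" .
  moreover have "real (Suc n) * r i \<le> (real (Suc n) + real i) * r i"
    using r_nn by (intro mult_right_mono) auto
  ultimately have "real (Suc n) * r i \<le> real (Suc n) * r 0 + real i" by linarith
  then show ?thesis by (simp add: r_def field_simps)
qed

text \<open>Upward counterpart of \<open>Z_ratio_down\<close>: the bounds on \<open>L\<close>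
  consecutive ratios telescope, so a small ratio at \<open>n\<close> forces fast growth of
  \<open>Z w m\<close> in the number of boxes.\<close>

lemma Z_ratio_up:
  assumes nn: "\<And>k. 0 \<le> w k" and w0: "0 < w 0" and pos: "0 < Z w m n"
    and r: "r = w 0 * Z w m n / Z w m (Suc n)"
  shows "w 0 ^ L * Z w m n \<le> (r + real L / real (Suc n)) ^ L * Z w m (n + L)"
proof -
  define C where "C = r + real L / real (Suc n)"
  have Zp: "0 < Z w m (n + i)" "0 < Z w m (Suc (n + i))" for i
    using Z_pos_add[OF nn w0 pos, of i] Z_pos_add[OF nn w0 pos, of "Suc i"] by auto
  have "0 \<le> C" using Zp[of 0] w0 by (simp add: C_def r)
  have "w 0 ^ i * Z w m n \<le> C ^ i * Z w m (n + i)" if "i \<le> L" for i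
    using that
  proof (induction i)
    case (Suc i)
    have "w 0 * Z w m (n + i) / Z w m (Suc (n + i)) \<le> r + real i / real (Suc n)"
      unfolding r by (rule Z_ratio_up_le[OF nn w0 pos])
    also have "\<dots> \<le> C" using Suc.prems by (simp add: C_def divide_right_mono)
    finally have *: "w 0 * Z w m (n + i) \<le> C * Z w m (Suc (n + i))"
      using Zp(2)[of i] by (simp add: field_simps)
    have "w 0 ^ Suc i * Z w m n \<le> w 0 * (C ^ i * Z w m (n + i))"
      using Suc w0 by (simp add: mult.assoc mult_left_mono)
    also have "\<dots> \<le> C ^ i * (C * Z w m (Suc (n + i)))"
      using mult_left_mono[OF *, of "C ^ i"] \<open>0 \<le> C\<close> by (simp add: mult_ac)
    finally show ?case by (simp add: mult_ac)
  qed simp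
  then show ?thesis by (simp add: C_def)
qed

section \<open>Limits of the ratio from bounds on the partition function\<close>

lemma power_le_power_imp_le:
  fixes a b :: real
  assumes "a ^ n \<le> b ^ n" "0 < n" "0 \<le> b"
  shows "a \<le> b"
  using assms power_le_imp_le_base[of a "n - 1" b] by simp

text \<open>\<open>P\<close> and \<open>T\<close> stand for \<Phi>(\<tau>) and \<tau>. A ratio
  \<open>r n\<close> well above \<open>w 0 / P\<close> would, going \<open>L\<close> boxes down,
  make \<open>Z w (m n) (n - L)\<close> exceed the bound \<open>up\<close>; one well below would do
  the same at \<open>n + L\<close>. Here \<open>L\<close> is about
  \<open>\<delta> * n\<close>.\<close>

lemma Z_ratio_tendsto_of_lower_bound:
  fixes w :: "nat \<Rightarrow> real" and m :: "nat \<Rightarrow> nat"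
  assumes nn: "\<And>k. 0 \<le> w k" and w0: "0 < w 0" and P: "0 < P" and T: "0 < T"
    and up: "\<And>M N. Z w M N * T ^ M \<le> P ^ N"
    and low: "\<And>\<eta>. 0 < \<eta> \<Longrightarrow> \<forall>\<^sub>F n in sequentially.
        0 < Z w (m n) n \<longrightarrow> exp (- \<eta> * real n) * P ^ n \<le> Z w (m n) n * T ^ m n"
  shows "((\<lambda>n. Z w (m n) (Suc n) / Z w (m n) n) \<longlongrightarrow> P)
    (inf sequentially (principal {n. 0 < Z w (m n) n}))"
proof -
  let ?F = "inf sequentially (principal {n. 0 < Z w (m n) n})"
  define c where "c = w 0 / P"
  have c0: "0 < c" using w0 P by (simp add: c_def)
  have "w 0 \<le> P" using up[of 0 1] by (simp only: Z_single) simp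
  then have c1: "c \<le> 1" using P by (simp add: c_def)
  define r where "r = (\<lambda>n. w 0 * Z w (m n) n / Z w (m n) (Suc n))"
  have "(r \<longlongrightarrow> c) ?F"
  proof (rule tendstoI)
    fix e :: real assume e: "0 < e"
    define \<delta> where "\<delta> = min (e / 4) (1 / 2)"
    have \<delta>: "0 < \<delta>" "\<delta> \<le> e / 4" "\<delta> \<le> 1 / 2" using e by (auto simp: \<delta>_def)
    \<comment> \<open>\<open>L\<close> will be at least \<open>\<delta> * n / 2\<close>, so the loss
      \<open>exp (\<eta> * n)\<close> in \<open>low\<close> is at most
      \<open>(1 + \<delta>) ^ L\<close>, a factor \<open>1 + \<delta>\<close> per step.\<close>
    define \<eta> where "\<eta> = \<delta> * ln (1 + \<delta>) / 2"
    have \<eta>: "0 < \<eta>" using \<delta> by (simp add: \<eta>_def)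
    have ev: "\<forall>\<^sub>F n in sequentially. 2 \<le> \<delta> * real n" "\<forall>\<^sub>F n in sequentially. 1 / real n \<le> \<delta>"
      using \<delta>(1) by real_asymp+
    have "\<forall>\<^sub>F n in sequentially. 0 < Z w (m n) n \<longrightarrow> dist (r n) c < e"
      using ev low[OF \<eta>] eventually_gt_at_top[of 0]
    proof eventually_elim
      case (elim n)
      show ?case
      proof
        assume pos: "0 < Z w (m n) n"
        define L where "L = nat \<lfloor>\<delta> * real n\<rfloor>"
        have L_le: "real L \<le> \<delta> * real n" and L_ge: "\<delta> * real n / 2 \<le> real L"
          using elim(1) unfolding L_def by linarith+
        have L0: "0 < L" using L_ge elim(1) by (cases L) auto
        have "\<delta> * real n \<le> 1 * real n" using \<delta> by (intro mult_right_mono) auto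
        then have Ln: "L \<le> n" using L_le by linarith
        have LN: "real L / real n \<le> \<delta>" using L_le elim(4) by (simp add: field_simps)
        define zt where "zt = Z w (m n) n * T ^ m n"
        have zt: "0 < zt" using pos T by (simp add: zt_def)
        have "\<eta> * real n \<le> real L * ln (1 + \<delta>)"
          using mult_right_mono[OF L_ge, of "ln (1 + \<delta>)"] \<delta> by (simp add: \<eta>_def mult_ac)
        then have "exp (\<eta> * real n) \<le> exp (real L * ln (1 + \<delta>))" by simp
        also have "\<dots> = (1 + \<delta>) ^ L" using \<delta> by (simp add: exp_of_nat_mult)
        finally have E: "exp (\<eta> * real n) \<le> (1 + \<delta>) ^ L" .
        have "P ^ n = exp (\<eta> * real n) * (exp (- \<eta> * real n) * P ^ n)"
          by (simp flip: exp_add mult.assoc)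
        also have "\<dots> \<le> (1 + \<delta>) ^ L * zt"
          using elim(3) pos E \<delta> P by (intro mult_mono) (auto simp: zt_def)
        finally have Pn: "P ^ n \<le> (1 + \<delta>) ^ L * zt" .

        \<comment> \<open>The descent starts at \<open>n\<close>, where \<open>Z\<close> is known to
          be positive, and so controls the ratio one index before \<open>r n\<close>;
          \<open>upper\<close> below then shifts by one box at the cost
          \<open>1 / n\<close>.\<close>
        have s_le: "s \<le> c + 2 * \<delta>" if s: "s = w 0 * Z w (m n) (n - 1) / Z w (m n) n" for s
        proof (cases "real L / real n \<le> s")
          case True
          have "(s - real L / real n) ^ L * zt \<le> w 0 ^ L * (Z w (m n) (n - L) * T ^ m n)"
            using mult_right_mono[OF Z_ratio_down[OF nn pos Ln, of 0 s], of "T ^ m n"] s True T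
            by (simp add: zt_def mult.assoc)
          also have "\<dots> \<le> w 0 ^ L * P ^ (n - L)"
            using w0 by (intro mult_left_mono up) auto
          also have "\<dots> = c ^ L * P ^ n"
            using P Ln by (simp add: c_def power_divide power_diff)
          also have "\<dots> \<le> c ^ L * ((1 + \<delta>) ^ L * zt)"
            using Pn c0 by (intro mult_left_mono) auto
          finally have "(s - real L / real n) ^ L \<le> (c * (1 + \<delta>)) ^ L"
            using zt by (simp add: power_mult_distrib mult.assoc[symmetric])
          then have "s - real L / real n \<le> c * (1 + \<delta>)"
            by (rule power_le_power_imp_le) (use L0 c0 \<delta> in auto)
          moreover have "c * \<delta> \<le> \<delta>" using c1 \<delta> by simp
          ultimately show ?thesis using LN by (simp add: algebra_simps)
        next
          case False
          then show ?thesis using LN c0 \<delta> by linarith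
        qed
        have upper: "r n \<le> c + 3 * \<delta>"
        proof -
          define A B C where "A = Z w (m n) (n - 1)" and "B = Z w (m n) n" and "C = Z w (m n) (Suc n)"
          have BC: "0 < B" "0 < C"
            using pos Z_pos_add[OF nn w0 pos, of 1] by (auto simp: B_def C_def)
          have "A \<ge> 0" by (simp add: A_def Z_nonneg nn)
          have s: "w 0 * A / B \<le> c + 2 * \<delta>" using s_le by (simp add: A_def B_def)
          have "(real n + 1) * (w 0 * B)\<^sup>2 \<le> (real n * ((w 0)\<^sup>2 * A) + w 0 * B) * C"
            using Z_ratio_step[where w = w and m = "m n" and n = "n - 1", OF nn] elim(4)
            by (simp add: A_def B_def C_def add.commute)
          moreover have "(real n * ((w 0)\<^sup>2 * A) + w 0 * B) * C
              = (w 0 * B) * ((real n * (w 0 * A / B) + 1) * C)"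
            using BC by (simp add: field_simps power2_eq_square)
          moreover have "(real n + 1) * (w 0 * B)\<^sup>2 = (w 0 * B) * ((real n + 1) * (w 0 * B))"
            by (simp add: power2_eq_square)
          ultimately have "(real n + 1) * (w 0 * B) \<le> (real n * (w 0 * A / B) + 1) * C"
            using BC w0 by (metis mult_le_cancel_left_pos mult_pos_pos)
          then have "(real n + 1) * r n \<le> real n * (w 0 * A / B) + 1"
            using BC by (simp add: r_def B_def[symmetric] C_def[symmetric] field_simps)
          moreover have "0 \<le> r n" using BC w0 by (simp add: r_def B_def[symmetric] C_def[symmetric])
          ultimately have "real n * r n \<le> real n * (w 0 * A / B) + 1" by (simp add: algebra_simps)
          then have "r n \<le> w 0 * A / B + 1 / real n" using elim(4) by (simp add: field_simps)
          then show ?thesis using s elim(2) by linarith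
        qed
        have lower: "c - 2 * \<delta> \<le> r n"
        proof -
          define b where "b = r n + real L / real (Suc n)"
          have Zp: "0 < Z w (m n) (Suc n)" using Z_pos_add[OF nn w0 pos, of 1] by simp
          have b: "0 \<le> b" using pos w0 Zp by (simp add: b_def r_def)
          have "w 0 ^ L * zt \<le> b ^ L * (Z w (m n) (n + L) * T ^ m n)"
            using mult_right_mono[OF Z_ratio_up[OF nn w0 pos, of "r n" L], of "T ^ m n"] T
            by (simp add: b_def zt_def r_def mult.assoc)
          also have "\<dots> \<le> b ^ L * P ^ (n + L)"
            using b by (intro mult_left_mono up) auto
          also have "\<dots> = (b * P) ^ L * P ^ n" by (simp add: power_add power_mult_distrib)
          also have "\<dots> \<le> (b * P) ^ L * ((1 + \<delta>) ^ L * zt)"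
            using Pn b P by (intro mult_left_mono) auto
          finally have "w 0 ^ L \<le> (b * P * (1 + \<delta>)) ^ L"
            using zt by (simp add: power_mult_distrib mult.assoc[symmetric])
          then have "w 0 \<le> b * P * (1 + \<delta>)"
            by (rule power_le_power_imp_le) (use L0 b P \<delta> in auto)
          then have "c \<le> b * (1 + \<delta>)" using P by (simp add: c_def field_simps)
          \<comment> \<open>Since \<open>(1 - \<delta>) * (1 + \<delta>) \<le> 1\<close>, the factor
            \<open>1 + \<delta>\<close> is traded for a loss of \<open>c * \<delta>\<close>.\<close>
          moreover have "c * (1 - \<delta>) * (1 + \<delta>) = c - c * \<delta>\<^sup>2"
            by (simp add: power2_eq_square algebra_simps)
          moreover have "0 \<le> c * \<delta>\<^sup>2" using c0 by simp
          ultimately have "c * (1 - \<delta>) * (1 + \<delta>) \<le> b * (1 + \<delta>)" by linarith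
          then have "c - c * \<delta> \<le> b" using \<delta> by (simp add: right_diff_distrib)
          moreover have "c * \<delta> \<le> \<delta>" using c1 \<delta> by simp
          moreover have "real L / real (Suc n) \<le> real L / real n"
            using elim(4) by (intro divide_left_mono) auto
          ultimately show ?thesis using LN unfolding b_def by linarith
        qed
        show "dist (r n) c < e"
          using upper lower \<delta> by (simp add: dist_real_def abs_less_iff)
      qed
    qed
    then show "\<forall>\<^sub>F n in ?F. dist (r n) c < e"
      by (simp add: eventually_inf_principal)
  qed
  then have "((\<lambda>n. w 0 / r n) \<longlongrightarrow> w 0 / c) ?F"
    using c0 by (intro tendsto_intros) auto
  moreover have "w 0 / c = P" using w0 P by (simp add: c_def)
  moreover have "\<forall>\<^sub>F n in ?F. w 0 / r n = Z w (m n) (Suc n) / Z w (m n) n"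
    using w0 by (simp add: eventually_inf_principal r_def)
  ultimately show ?thesis by (simp add: Lim_transform_eventually)
qed

section \<open>Limits equal to \<open>w 0\<close>: zero density and zero radius of
  convergence\<close>

text \<open>Non-empty boxes are rare: sizes below a cutoff \<open>J\<close> by \<open>small\<close>,
  sizes from \<open>J\<close> on by Markov's inequality, since the mean load stays bounded. So
  almost all boxes are empty and the proportion \<open>r n\<close> tends to 1.\<close>

lemma Z_ratio_tendsto_w0:
  fixes w :: "nat \<Rightarrow> real" and m :: "nat \<Rightarrow> nat"
  assumes nn: "\<And>k. 0 \<le> w k" and w0: "0 < w 0" and l: "0 \<le> l"
    and mn: "(\<lambda>n. real (m n) / real n) \<longlonglongrightarrow> l"
    and small: "\<And>j e. 0 < j \<Longrightarrow> 0 < e \<Longrightarrow> \<forall>\<^sub>F n in sequentially.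
        0 < Z w (m n) n \<longrightarrow> j \<le> m n \<longrightarrow> w j * Z w (m n - j) n \<le> e * Z w (m n) (Suc n)"
  shows "((\<lambda>n. Z w (m n) (Suc n) / Z w (m n) n) \<longlongrightarrow> w 0)
    (inf sequentially (principal {n. 0 < Z w (m n) n}))"
proof -
  let ?F = "inf sequentially (principal {n. 0 < Z w (m n) n})"
  define r where "r = (\<lambda>n. w 0 * Z w (m n) n / Z w (m n) (Suc n))"
  have "(r \<longlongrightarrow> 1) ?F"
  proof (rule tendstoI)
    fix e :: real assume e: "0 < e"
    \<comment> \<open>\<open>J\<close> is the Markov cutoff: sizes from \<open>J\<close> on have
      total frequency below \<open>e / 2\<close>. The bound \<open>e / (2 * J)\<close> required of
      \<open>small\<close> shares the other \<open>e / 2\<close> among the fewer than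
      \<open>J\<close> smaller positive sizes.\<close>
    obtain J where J: "2 * (l + 1) / e < real J" using reals_Archimedean2 by blast
    have "0 < 2 * (l + 1) / e" using l e by simp
    then have J0: "0 < real J" using J by linarith
    have Je: "(l + 1) / real J < e / 2" using J J0 e by (simp add: field_simps)
    have "\<forall>\<^sub>F n in sequentially. real (m n) / real n < l + 1"
      using order_tendstoD(2)[OF mn, of "l + 1"] by simp
    moreover have "\<forall>\<^sub>F n in sequentially. \<forall>j\<in>{1..<J}. 0 < Z w (m n) n \<longrightarrow> j \<le> m n \<longrightarrow>
        w j * Z w (m n - j) n \<le> e / (2 * real J) * Z w (m n) (Suc n)"
      using e J0 by (intro eventually_ball_finite ballI small) auto
    ultimately have "\<forall>\<^sub>F n in sequentially. 0 < Z w (m n) n \<longrightarrow> dist (r n) 1 < e"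
      using eventually_gt_at_top[of 0]
    proof eventually_elim
      case (elim n)
      show ?case
      proof
        assume pos: "0 < Z w (m n) n"
        define C where "C = Z w (m n) (Suc n)"
        have C: "0 < C" using Z_pos_add[OF nn w0 pos, of 1] by (simp add: C_def)
        have t_nn: "0 \<le> w k * Z w (m n - k) n" for k by (simp add: nn Z_nonneg)
        have "C = w 0 * Z w (m n) n + (\<Sum>k\<in>{1..m n}. w k * Z w (m n - k) n)"
          by (simp add: C_def Z_Suc atMost_atLeast0 sum.atLeast_Suc_atMost)
        moreover have "(\<Sum>k\<in>{1..m n}. w k * Z w (m n - k) n)
            \<le> (\<Sum>k\<in>{1..m n}. (if k < J then e / (2 * real J) * C else 0)
                + real k * w k * Z w (m n - k) n / real J)"
        proof (rule sum_mono)
          fix k assume k: "k \<in> {1..m n}"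
          show "w k * Z w (m n - k) n \<le> (if k < J then e / (2 * real J) * C else 0)
                + real k * w k * Z w (m n - k) n / real J"
          proof (cases "k < J")
            case True
            moreover have "0 \<le> real k * (w k * Z w (m n - k) n) / real J" using t_nn[of k] by simp
            ultimately show ?thesis using elim(2) k pos by (simp add: C_def mult.assoc add_increasing2)
          next
            case False
            then have "real J * (w k * Z w (m n - k) n) \<le> real k * (w k * Z w (m n - k) n)"
              by (intro mult_right_mono t_nn) auto
            then show ?thesis using False J0 by (simp add: field_simps)
          qed
        qed
        moreover have "\<dots> = (\<Sum>k\<in>{1..m n}. if k < J then e / (2 * real J) * C else 0)
            + (\<Sum>k\<in>{1..m n}. real k * w k * Z w (m n - k) n) / real J"
          by (simp add: sum.distrib sum_divide_distrib)
        moreover have "(\<Sum>k\<in>{1..m n}. if k < J then e / (2 * real J) * C else 0) \<le> e / 2 * C"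
        proof -
          have "(\<Sum>k\<in>{1..m n}. if k < J then e / (2 * real J) * C else 0)
             \<le> (\<Sum>k\<in>{..<J} \<union> {1..m n}. if k < J then e / (2 * real J) * C else 0)"
            using e C by (intro sum_mono2) auto
          also have "\<dots> = (\<Sum>k\<in>{..<J}. e / (2 * real J) * C)"
            by (intro sum.mono_neutral_cong_right) auto
          finally show ?thesis using J0 by simp
        qed
        moreover have "(\<Sum>k\<in>{1..m n}. real k * w k * Z w (m n - k) n) / real J < e / 2 * C"
        proof -
          have "(\<Sum>k\<in>{1..m n}. real k * w k * Z w (m n - k) n) = (\<Sum>k\<le>m n. real k * w k * Z w (m n - k) n)"
            by (simp add: atMost_atLeast0 sum.atLeast_Suc_atMost)
          also have "\<dots> = real (m n) / real (Suc n) * C"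
            using Z_size_biased[of "m n" w n] by (simp add: C_def field_simps)
          also have "\<dots> \<le> real (m n) / real n * C"
            using C elim(3) by (intro mult_right_mono divide_left_mono) auto
          also have "\<dots> \<le> (l + 1) * C" using elim(1) C by (intro mult_right_mono) auto
          finally have "(\<Sum>k\<in>{1..m n}. real k * w k * Z w (m n - k) n) / real J \<le> (l + 1) / real J * C"
            using J0 by (simp add: field_simps)
          also have "\<dots> < e / 2 * C" using Je C by (intro mult_strict_right_mono) auto
          finally show ?thesis .
        qed
        ultimately have "C - w 0 * Z w (m n) n < e * C" by (simp add: field_simps)
        moreover have "w 0 * Z w (m n) n \<le> C" unfolding C_def by (rule Z_Suc_ge[OF nn])
        ultimately have "1 - r n < e" "r n \<le> 1"
          using C by (auto simp: r_def C_def[symmetric] field_simps)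
        then show "dist (r n) 1 < e" by (simp add: dist_real_def)
      qed
    qed
    then show "\<forall>\<^sub>F n in ?F. dist (r n) 1 < e"
      by (simp add: eventually_inf_principal)
  qed
  then have "((\<lambda>n. w 0 / r n) \<longlongrightarrow> w 0 / 1) ?F"
    by (intro tendsto_intros) auto
  moreover have "\<forall>\<^sub>F n in ?F. w 0 / r n = Z w (m n) (Suc n) / Z w (m n) n"
    using w0 by (simp add: eventually_inf_principal r_def)
  ultimately show ?thesis by (simp add: Lim_transform_eventually)
qed

text \<open>The frequency of a size \<open>j \<ge> 1\<close> is at most the mean load
  \<open>m / Suc n\<close> of a box, which tends to 0.\<close>

lemma Z_ratio_tendsto_zero_density:
  fixes w :: "nat \<Rightarrow> real" and m :: "nat \<Rightarrow> nat"
  assumes nn: "\<And>k. 0 \<le> w k" and w0: "0 < w 0"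
    and mn: "(\<lambda>n. real (m n) / real n) \<longlonglongrightarrow> 0"
  shows "((\<lambda>n. Z w (m n) (Suc n) / Z w (m n) n) \<longlongrightarrow> w 0)
    (inf sequentially (principal {n. 0 < Z w (m n) n}))"
proof (rule Z_ratio_tendsto_w0[where w = w and m = m, OF nn w0 _ mn])
  fix j :: nat and e :: real assume j: "0 < j" and e: "0 < e"
  have "\<forall>\<^sub>F n in sequentially. real (m n) / real n < e"
    using order_tendstoD(2)[OF mn e] .
  then show "\<forall>\<^sub>F n in sequentially.
        0 < Z w (m n) n \<longrightarrow> j \<le> m n \<longrightarrow> w j * Z w (m n - j) n \<le> e * Z w (m n) (Suc n)"
    using eventually_gt_at_top[of 0]
  proof (eventually_elim, intro impI)
    fix n assume n: "real (m n) / real n < e" "0 < n" "j \<le> m n"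
    have t_nn: "0 \<le> w k * Z w (m n - k) n" for k by (simp add: nn Z_nonneg)
    have "w j * Z w (m n - j) n \<le> real j * (w j * Z w (m n - j) n)"
      using j t_nn[of j] mult_right_mono[of 1 "real j"] by force
    also have "\<dots> = (\<Sum>k\<in>{j}. real k * w k * Z w (m n - k) n)" by simp
    also have "\<dots> \<le> (\<Sum>k\<le>m n. real k * w k * Z w (m n - k) n)"
      using n t_nn by (intro sum_mono2) (auto simp: mult.assoc)
    also have "\<dots> = real (m n) / real (Suc n) * Z w (m n) (Suc n)"
      using Z_size_biased[of "m n" w n] by (simp add: field_simps)
    also have "\<dots> \<le> real (m n) / real n * Z w (m n) (Suc n)"
      using n by (intro mult_right_mono divide_left_mono Z_nonneg nn) auto
    also have "\<dots> \<le> e * Z w (m n) (Suc n)"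
      using n by (intro mult_right_mono Z_nonneg nn) auto
    finally show "w j * Z w (m n - j) n \<le> e * Z w (m n) (Suc n)" .
  qed
qed simp

text \<open>If the inequality failed for every \<open>K \<ge> j\<close>, then \<open>w K\<close>
  would grow at most geometrically in \<open>K\<close>, contradicting radius zero.\<close>

lemma conv_radius_zero_large_weight:
  fixes w :: "nat \<Rightarrow> real"
  assumes nn: "\<And>k. 0 \<le> w k" and w0: "0 < w 0" and rho: "conv_radius w = 0"
    and j: "0 < j" and e: "0 < e"
  shows "\<exists>K\<ge>j. w j ^ K \<le> e ^ K * (w K ^ j * w 0 ^ (K - j))"
proof (rule ccontr)
  assume neg: "\<not> ?thesis"
  have *: "e ^ K * (w K ^ j * w 0 ^ (K - j)) < w j ^ K" if "j \<le> K" for K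
    using that neg by (meson not_le)
  \<comment> \<open>The maximum with 1 gives \<open>D ^ K \<le> (D ^ K) ^ j\<close>, after which a
    \<open>j\<close>-th root can be taken.\<close>
  define D where "D = max 1 (w j / (e * w 0))"
  have D: "1 \<le> D" "w j \<le> D * (e * w 0)" using e w0 by (auto simp: D_def field_simps max_def)
  have "w K \<le> D ^ K * w 0" if K: "j \<le> K" for K
  proof -
    have "e ^ K * (w K ^ j * w 0 ^ (K - j)) \<le> w j ^ K" using *[OF K] by simp
    also have "\<dots> \<le> (D * (e * w 0)) ^ K" using D(2) nn by (intro power_mono) auto
    also have "\<dots> = e ^ K * ((D ^ K * w 0 ^ j) * w 0 ^ (K - j))"
      using K by (simp add: power_mult_distrib flip: power_add)
    finally have "w K ^ j \<le> D ^ K * w 0 ^ j" using e w0 by simp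
    also have "\<dots> \<le> (D ^ K) ^ j * w 0 ^ j"
      using j D w0 by (intro mult_right_mono self_le_power one_le_power) auto
    finally have "w K ^ j \<le> (D ^ K * w 0) ^ j" by (simp add: power_mult_distrib)
    then show ?thesis
      by (rule power_le_power_imp_le) (use j D w0 in auto)
  qed
  \<comment> \<open>At the point \<open>1 / (2 * D)\<close> the terms are dominated by a geometric
    series of ratio 1/2, so the radius would be positive.\<close>
  then have bound: "norm (w K * (1 / (2 * D)) ^ K) \<le> w 0 * (1 / 2) ^ K" if "j \<le> K" for K
    using that D nn[of K] by (simp add: power_mult_distrib power_divide field_simps)
  have "summable (\<lambda>K. w K * (1 / (2 * D)) ^ K)"
    by (rule summable_comparison_test'[OF _ bound]) (auto intro!: summable_mult summable_geometric)
  then have "ereal (norm (1 / (2 * D))) \<le> conv_radius w"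
    by (rule conv_radius_geI)
  then show False using rho D by simp
qed

text \<open>\<open>Z_ratio_down\<close> is used with a fixed number \<open>L = K\<close> of boxes,
  so its error \<open>K / Suc n\<close> vanishes; the exchange of ball arrangements bounds the
  frequency of size \<open>j\<close> by \<open>e / 2\<close> plus this error.\<close>

lemma Z_ratio_tendsto_zero_radius:
  fixes w :: "nat \<Rightarrow> real" and m :: "nat \<Rightarrow> nat"
  assumes nn: "\<And>k. 0 \<le> w k" and w0: "0 < w 0" and l: "0 < l"
    and mn: "(\<lambda>n. real (m n) / real n) \<longlonglongrightarrow> l"
    and rho: "conv_radius w = 0"
  shows "((\<lambda>n. Z w (m n) (Suc n) / Z w (m n) n) \<longlongrightarrow> w 0)
    (inf sequentially (principal {n. 0 < Z w (m n) n}))"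
proof (rule Z_ratio_tendsto_w0[where w = w and m = m, OF nn w0 _ mn])
  fix j :: nat and e :: real assume j: "0 < j" and e: "0 < e"
  \<comment> \<open>\<open>K\<close> boxes with \<open>j\<close> balls are far less likely than \<open>j\<close> boxes with \<open>K\<close> balls and \<open>K - j\<close> empty ones.\<close>
  obtain K where K: "j \<le> K" "w j ^ K \<le> (e / 2) ^ K * (w K ^ j * w 0 ^ (K - j))"
    using conv_radius_zero_large_weight[OF nn w0 rho j, of "e / 2"] e by auto
  \<comment> \<open>Since \<open>l > 0\<close>, the number of balls tends to infinity and eventually
    covers the \<open>j * K\<close> balls of the exchange.\<close>
  have "filterlim (\<lambda>n. real (m n) / real n * real n) at_top sequentially"
    by (rule filterlim_tendsto_pos_mult_at_top[OF mn l filterlim_real_sequentially])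
  then have "\<forall>\<^sub>F n in sequentially. real (j * K) \<le> real (m n) / real n * real n"
    by (simp add: filterlim_at_top)
  moreover have "\<forall>\<^sub>F n in sequentially. real K / real (Suc n) \<le> e / 2"
    using e by real_asymp
  ultimately show "\<forall>\<^sub>F n in sequentially.
        0 < Z w (m n) n \<longrightarrow> j \<le> m n \<longrightarrow> w j * Z w (m n - j) n \<le> e * Z w (m n) (Suc n)"
    using eventually_gt_at_top[of K]
  proof (eventually_elim, intro impI)
    fix n assume n: "real (j * K) \<le> real (m n) / real n * real n" "real K / real (Suc n) \<le> e / 2" "K < n"
      "j \<le> m n" and pos: "0 < Z w (m n) n"
    define C where "C = Z w (m n) (Suc n)"
    have C: "0 < C" using Z_pos_add[OF nn w0 pos, of 1] by (simp add: C_def)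
    have jK: "j * K \<le> m n" using n(1,3) by (simp del: of_nat_mult)
    define s where "s = w j * Z w (m n - j) n / C"
    have "s \<le> e"
    proof (cases "real K / real (Suc n) \<le> s")
      case True
      have "(s - real K / real (Suc n)) ^ K * C \<le> w j ^ K * Z w (m n - j * K) (Suc n - K)"
        using Z_ratio_down[where w = w and m = "m n" and N = "Suc n" and L = K and j = j and s = s, OF nn] n True jK C by (simp add: s_def C_def)
      also have "\<dots> \<le> (e / 2) ^ K * ((w K ^ j * w 0 ^ (K - j)) * Z w (m n - j * K) (Suc n - K))"
        using mult_right_mono[OF K(2) Z_nonneg[OF nn]] by (simp add: mult.assoc)
      also have "\<dots> \<le> (e / 2) ^ K * C"
      proof (rule mult_left_mono)
        have "w K ^ j * w 0 ^ (K - j) \<le> Z w (j * K) (j * 1) * Z w ((K - j) * 0) ((K - j) * 1)"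
          using Z_mult_ge[of w K 1 j] Z_mult_ge[of w 0 1 "K - j"] nn
          unfolding Z_single by (intro mult_mono Z_nonneg) auto
        also have "\<dots> \<le> Z w (j * K) K"
          using Z_add_ge[of w "j * K" j 0 "K - j"] K nn by simp
        finally have "(w K ^ j * w 0 ^ (K - j)) * Z w (m n - j * K) (Suc n - K)
            \<le> Z w (j * K) K * Z w (m n - j * K) (Suc n - K)"
          by (intro mult_right_mono Z_nonneg nn)
        also have "\<dots> \<le> C"
          using Z_add_ge[of w "j * K" K "m n - j * K" "Suc n - K"] jK n nn by (simp add: C_def)
        finally show "(w K ^ j * w 0 ^ (K - j)) * Z w (m n - j * K) (Suc n - K) \<le> C" .
      qed (use e in auto)
      finally have "(s - real K / real (Suc n)) ^ K \<le> (e / 2) ^ K" using C by simp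
      then have "s - real K / real (Suc n) \<le> e / 2"
        by (rule power_le_power_imp_le) (use j K e in auto)
      then show ?thesis using n(2) by linarith
    next
      case False
      then show ?thesis using n(2) e by linarith
    qed
    then show "w j * Z w (m n - j) n \<le> e * Z w (m n) (Suc n)"
      using C by (simp add: s_def C_def[symmetric] field_simps)
  qed
qed (use l in simp)

section \<open>Exponential lower bound\<close>

text \<open>With \<open>t = exp x\<close> the sum is the truncation of \<Phi>(t) divided by
  \<open>t powr l\<close>. As \<open>0 < l < b\<close>, the term of index 0 blows up towards minus
  infinity and the term of index \<open>b\<close> towards plus infinity, so sublevel sets are
  bounded.\<close>

lemma truncated_sublevel_compact:
  fixes w :: "nat \<Rightarrow> real"
  assumes nn: "\<And>k. 0 \<le> w k" and w0: "0 < w 0" and wb: "0 < w b"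
    and l: "0 < l" "l < real b" and K: "b \<le> K"
  shows "compact {x. (\<Sum>k\<le>K. w k * exp ((real k - l) * x)) \<le> c}"
proof (cases "0 < c")
  case True
  have term_le: "w j * exp ((real j - l) * x) \<le> (\<Sum>k\<le>K. w k * exp ((real k - l) * x))"
    if "j \<le> K" for j x
    using that by (intro member_le_sum) (auto simp: nn)
  have "closed {x. (\<Sum>k\<le>K. w k * exp ((real k - l) * x)) \<le> c}"
    by (intro closed_Collect_le continuous_intros)
  moreover have "{x. (\<Sum>k\<le>K. w k * exp ((real k - l) * x)) \<le> c}
      \<subseteq> {- ln (c / w 0) / l..ln (c / w b) / (real b - l)}"
  proof safe
    fix x assume x: "(\<Sum>k\<le>K. w k * exp ((real k - l) * x)) \<le> c"
    have "exp (- l * x) \<le> c / w 0" using term_le[of 0 x] x w0 by (simp add: field_simps)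
    then have "- l * x \<le> ln (c / w 0)" using True w0 by (simp add: ln_ge_iff)
    moreover have "exp ((real b - l) * x) \<le> c / w b" using term_le[of b x] K x wb by (simp add: field_simps)
    then have "(real b - l) * x \<le> ln (c / w b)" using True wb by (simp add: ln_ge_iff)
    ultimately show "x \<in> {- ln (c / w 0) / l..ln (c / w b) / (real b - l)}"
      using l by (simp add: field_simps)
  qed
  ultimately show ?thesis
    by (meson bounded_closed_interval bounded_subset compact_eq_bounded_closed)
next
  case False
  have "\<not> (\<Sum>k\<le>K. w k * exp ((real k - l) * x)) \<le> c" for x
  proof -
    have "0 < w 0 * exp ((real 0 - l) * x)" using w0 by simp
    also have "\<dots> \<le> (\<Sum>k\<le>K. w k * exp ((real k - l) * x))"
      by (rule member_le_sum[of 0]) (auto simp: nn)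
    finally show ?thesis using False by linarith
  qed
  then show ?thesis by simp
qed

text \<open>Dini-type argument: if every truncation dipped below \<open>V'\<close>, the nested
  compact sublevel sets would share a point, at which the full series converges with sum at most
  \<open>V' < V\<close>.\<close>

lemma truncation_lower_bound:
  fixes w :: "nat \<Rightarrow> real"
  assumes nn: "\<And>k. 0 \<le> w k" and w0: "0 < w 0" and wb: "0 < w b"
    and l: "0 < l" "l < real b"
    and V: "\<And>x. summable (\<lambda>k. w k * exp ((real k - l) * x)) \<Longrightarrow> V \<le> (\<Sum>k. w k * exp ((real k - l) * x))"
    and V': "V' < V"
  shows "\<exists>K\<ge>b. \<forall>x. V' \<le> (\<Sum>k\<le>K. w k * exp ((real k - l) * x))"
proof (rule ccontr)
  assume neg: "\<not> ?thesis"
  define C where "C = (\<lambda>i. {x. (\<Sum>k\<le>b + i. w k * exp ((real k - l) * x)) \<le> V'})"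
  have "\<Inter> (range C) \<noteq> {}"
  proof (rule compact_nest)
    show "compact (C i)" for i
      unfolding C_def by (rule truncated_sublevel_compact[OF nn w0 wb l]) simp
    show "C i \<noteq> {}" for i
    proof -
      obtain x where "\<not> V' \<le> (\<Sum>k\<le>b + i. w k * exp ((real k - l) * x))"
        using neg by (meson le_add1)
      then have "x \<in> C i" by (simp add: C_def)
      then show ?thesis by blast
    qed
    show "C j \<subseteq> C i" if "i \<le> j" for i j
    proof -
      have "(\<Sum>k\<le>b + i. w k * exp ((real k - l) * x)) \<le> (\<Sum>k\<le>b + j. w k * exp ((real k - l) * x))" for x
        using that by (intro sum_mono2) (auto simp: nn)
      then show ?thesis by (auto simp: C_def intro: order_trans)
    qed
  qed
  then obtain x where x: "\<And>i. (\<Sum>k\<le>b + i. w k * exp ((real k - l) * x)) \<le> V'"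
    by (auto simp: C_def)
  have t_nn: "0 \<le> w k * exp ((real k - l) * x)" for k by (simp add: nn)
  have part: "(\<Sum>k<i. w k * exp ((real k - l) * x)) \<le> V'" for i
  proof -
    have "(\<Sum>k<i. w k * exp ((real k - l) * x)) \<le> (\<Sum>k\<le>b + i. w k * exp ((real k - l) * x))"
      by (intro sum_mono2) (auto simp: nn)
    then show ?thesis using x[of i] by linarith
  qed
  have sm: "summable (\<lambda>k. w k * exp ((real k - l) * x))"
    by (rule summableI_nonneg_bounded[OF t_nn part])
  then have "(\<Sum>k. w k * exp ((real k - l) * x)) \<le> V'"
    by (rule suminf_le_const) (rule part)
  with V[OF sm] V' show False by linarith
qed

text \<open>The \<open>n\<close>-th power of the truncated polynomial has degree at most
  \<open>K * n\<close>, so only linearly many totals \<open>M\<close> occur. This lets a single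
  \<open>M\<close> be exponentially as large as the whole sum.\<close>

lemma Z_truncated_sum:
  fixes w :: "nat \<Rightarrow> real"
  defines "u \<equiv> \<lambda>K k. if k \<le> K then w k else 0"
  shows "\<exists>D\<le>K * n. \<forall>x. (\<Sum>M\<le>D. Z (u K) M n * exp ((real M - l * real n) * x))
      = (\<Sum>k\<le>K. w k * exp ((real k - l) * x)) ^ n"
proof -
  define p where "p = (\<Sum>k\<le>K. monom (w k) k)"
  have cp: "coeff p k = u K k" for k
    by (simp add: p_def coeff_sum u_def sum.delta')
  have "fps_of_poly p = Abs_fps (u K)" by (rule fps_ext) (simp add: cp)
  then have Zc: "Z (u K) M n = coeff (p ^ n) M" for M
    by (metis Z_eq_fps_power_nth fps_of_poly_nth fps_of_poly_power)
  have "degree p \<le> K" unfolding p_def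
    by (intro degree_sum_le) (auto intro: order_trans[OF degree_monom_le])
  then have "degree p * n \<le> K * n" by simp
  then have "degree (p ^ n) \<le> K * n" using degree_power_le[of p n] by linarith
  moreover have "(\<Sum>M\<le>degree (p ^ n). Z (u K) M n * exp ((real M - l * real n) * x))
      = (\<Sum>k\<le>K. w k * exp ((real k - l) * x)) ^ n" for x
  proof -
    have e: "exp ((real k - a) * x) = exp x ^ k * exp (- a * x)" for k a
      by (simp add: exp_add[symmetric] exp_of_nat_mult[symmetric] algebra_simps)
    have "(\<Sum>M\<le>degree (p ^ n). Z (u K) M n * exp ((real M - l * real n) * x))
        = exp (- (l * real n) * x) * poly (p ^ n) (exp x)"
      unfolding e Zc poly_altdef[of "p ^ n"] sum_distrib_left by (simp add: mult_ac)
    also have "exp (- (l * real n) * x) = exp (- l * x) ^ n"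
      by (simp add: exp_of_nat_mult[symmetric] mult_ac)
    also have "\<dots> * poly (p ^ n) (exp x) = (exp (- l * x) * poly p (exp x)) ^ n"
      by (simp add: power_mult_distrib)
    also have "exp (- l * x) * poly p (exp x) = (\<Sum>k\<le>K. w k * exp ((real k - l) * x))"
      unfolding e p_def poly_sum poly_monom sum_distrib_left by (simp add: mult_ac)
    finally show ?thesis .
  qed
  ultimately show ?thesis by blast
qed

text \<open>The minimum over the compact sublevel set through 0 is global, because \<open>H\<close>
  exceeds \<open>H 0\<close> elsewhere.\<close>

lemma truncated_critical_point:
  fixes w :: "nat \<Rightarrow> real"
  assumes nn: "\<And>k. 0 \<le> w k" and w0: "0 < w 0" and wb: "0 < w b"
    and l: "0 < l" "l < real b" and K: "b \<le> K"
  defines "H \<equiv> \<lambda>x. \<Sum>k\<le>K. w k * exp ((real k - l) * x)"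
  shows "\<exists>x0. (H has_real_derivative 0) (at x0)"
proof -
  let ?S = "{x. H x \<le> H 0}"
  have "compact ?S" unfolding H_def by (rule truncated_sublevel_compact[OF nn w0 wb l K])
  moreover have "?S \<noteq> {}" by auto
  moreover have "continuous_on ?S H" unfolding H_def by (intro continuous_intros)
  ultimately obtain x0 where x0: "x0 \<in> ?S" "\<And>x. x \<in> ?S \<Longrightarrow> H x0 \<le> H x"
    using continuous_attains_inf by metis
  then have min: "H x0 \<le> H x" for x by (cases "x \<in> ?S") force+
  have D: "(H has_real_derivative (\<Sum>k\<le>K. w k * (exp ((real k - l) * x0) * (real k - l)))) (at x0)"
    unfolding H_def by (auto intro!: derivative_eq_intros sum.cong)
  have "(\<Sum>k\<le>K. w k * (exp ((real k - l) * x0) * (real k - l))) = 0"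
    by (rule DERIV_local_min[OF D, of 1]) (auto simp: min)
  with D show ?thesis by auto
qed

text \<open>For the truncated weight \<open>u\<close>, the numbers
  \<open>Z u M n * exp ((M - l * n) * x0)\<close> sum to \<open>h ^ n\<close>; at a critical point
  \<open>x0\<close> the resulting distribution of \<open>M\<close> has mean \<open>l * n\<close>.
  Chernoff bounds on both tails leave more than half of the mass near \<open>l * n\<close>, and one
  of the linearly many \<open>M\<close> there must be large.\<close>

lemma Z_concentration_lower_bound:
  fixes w :: "nat \<Rightarrow> real"
  assumes nn: "\<And>k. 0 \<le> w k" and w0: "0 < w 0" and wb: "0 < w b"
    and l: "0 < l" "l < real b" and K: "b \<le> K"
    and V: "0 < V" "\<And>x. V \<le> (\<Sum>k\<le>K. w k * exp ((real k - l) * x))"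
    and \<epsilon>: "0 < \<epsilon>" and \<eta>: "0 < \<eta>"
  shows "\<forall>\<^sub>F n in sequentially. \<exists>M. \<bar>real M - l * real n\<bar> \<le> \<epsilon> * real n \<and> (V * exp (- \<eta>)) ^ n \<le> Z w M n"
proof -
  define H where "H = (\<lambda>x. \<Sum>k\<le>K. w k * exp ((real k - l) * x))"
  obtain x0 where D: "(H has_real_derivative 0) (at x0)"
    using truncated_critical_point[OF nn w0 wb l K] unfolding H_def by blast
  define h where "h = H x0"
  have hV: "V \<le> h" "0 < h" using V(2)[of x0] V(1) by (auto simp: h_def H_def)
  \<comment> \<open>For \<open>M\<close> within \<open>\<epsilon>' * n\<close> of
    \<open>l * n\<close> the factor \<open>exp ((M - l * n) * x0)\<close> is then at most
    \<open>exp (\<eta> * n / 2)\<close>; the \<open>+ 1\<close> covers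
    \<open>x0 = 0\<close>.\<close>
  define \<epsilon>' where "\<epsilon>' = min \<epsilon> (\<eta> / (2 * (\<bar>x0\<bar> + 1)))"
  have \<epsilon>': "0 < \<epsilon>'" "\<epsilon>' \<le> \<epsilon>" "\<epsilon>' * \<bar>x0\<bar> \<le> \<eta> / 2"
  proof -
    show "0 < \<epsilon>'" "\<epsilon>' \<le> \<epsilon>" using \<epsilon> \<eta> by (auto simp: \<epsilon>'_def)
    have "\<epsilon>' * \<bar>x0\<bar> \<le> \<eta> / (2 * (\<bar>x0\<bar> + 1)) * (\<bar>x0\<bar> + 1)"
      using \<epsilon> \<eta> by (intro mult_mono) (auto simp: \<epsilon>'_def)
    also have "\<dots> = \<eta> / 2" by (simp add: field_simps)
    finally show "\<epsilon>' * \<bar>x0\<bar> \<le> \<eta> / 2" .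
  qed
  \<comment> \<open>As \<open>H\<close> is stationary at \<open>x0\<close>, the exponential factor
    decides the sign of the slope: a small step to the right lowers the product, which gives the
    Chernoff bound for the upper tail. The step to the left below serves the lower tail.\<close>
  have "((\<lambda>x. H x * exp (- \<epsilon>' * x)) has_real_derivative - \<epsilon>' * h * exp (- \<epsilon>' * x0)) (at x0)"
    by (auto intro!: derivative_eq_intros D simp: h_def)
  then obtain d2 where d2: "d2 > 0" "\<And>y. 0 < y \<Longrightarrow> y < d2 \<Longrightarrow>
      H (x0 + y) * exp (- \<epsilon>' * (x0 + y)) < H x0 * exp (- \<epsilon>' * x0)"
    using DERIV_neg_dec_right[of "\<lambda>x. H x * exp (- \<epsilon>' * x)"] \<epsilon>'(1) hV
    by (metis (no_types, lifting) exp_gt_zero mult_minus_left mult_pos_pos neg_less_0_iff_less)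
  have "((\<lambda>x. H x * exp (\<epsilon>' * x)) has_real_derivative \<epsilon>' * h * exp (\<epsilon>' * x0)) (at x0)"
    by (auto intro!: derivative_eq_intros D simp: h_def)
  then obtain d1 where d1: "d1 > 0" "\<And>y. 0 < y \<Longrightarrow> y < d1 \<Longrightarrow>
      H (x0 - y) * exp (\<epsilon>' * (x0 - y)) < H x0 * exp (\<epsilon>' * x0)"
    using DERIV_pos_inc_left[of "\<lambda>x. H x * exp (\<epsilon>' * x)"] \<epsilon>'(1) hV
    by (metis (no_types, lifting) exp_gt_zero mult_pos_pos)
  define y1 y2 where "y1 = d1 / 2" and "y2 = d2 / 2"
  have y: "0 < y1" "0 < y2" using d1 d2 by (auto simp: y1_def y2_def)
  define x1 x2 where "x1 = x0 - y1" and "x2 = x0 + y2"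
  \<comment> \<open>\<open>q1\<close> and \<open>q2\<close> are the decay factors per box of the
    lower and the upper tail, relative to \<open>h\<close>.\<close>
  define q1 q2 where "q1 = H x1 * exp (- \<epsilon>' * y1) / h" and "q2 = H x2 * exp (- \<epsilon>' * y2) / h"
  have H_nn: "0 \<le> H x" for x by (simp add: H_def sum_nonneg nn)
  have q2: "0 \<le> q2" "q2 < 1"
  proof -
    show "0 \<le> q2" using H_nn hV by (simp add: q2_def)
    have "exp (- \<epsilon>' * (x0 + y2)) = exp (- \<epsilon>' * y2) * exp (- \<epsilon>' * x0)"
      by (simp add: exp_add[symmetric] algebra_simps)
    then have "H x2 * exp (- \<epsilon>' * y2) * exp (- \<epsilon>' * x0) < h * exp (- \<epsilon>' * x0)"
      using d2(2)[of y2] y d2(1) by (simp add: x2_def y2_def h_def mult.assoc)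
    then show "q2 < 1" using hV by (simp add: q2_def)
  qed
  have q1: "0 \<le> q1" "q1 < 1"
  proof -
    show "0 \<le> q1" using H_nn hV by (simp add: q1_def)
    have "exp (\<epsilon>' * (x0 - y1)) = exp (- \<epsilon>' * y1) * exp (\<epsilon>' * x0)"
      by (simp add: exp_add[symmetric] algebra_simps)
    then have "H x1 * exp (- \<epsilon>' * y1) * exp (\<epsilon>' * x0) < h * exp (\<epsilon>' * x0)"
      using d1(2)[of y1] y d1(1) by (simp add: x1_def y1_def h_def mult.assoc)
    then show "q1 < 1" using hV by (simp add: q1_def)
  qed
  have "\<forall>\<^sub>F n in sequentially. q1 ^ n < 1 / 4" "\<forall>\<^sub>F n in sequentially. q2 ^ n < 1 / 4"
    using order_tendstoD(2)[OF LIMSEQ_realpow_zero[OF q1], of "1/4"]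
      order_tendstoD(2)[OF LIMSEQ_realpow_zero[OF q2], of "1/4"] by auto
  \<comment> \<open>This beats the at most \<open>K * n + 1\<close> terms in the window, with a
    factor 2 to spare.\<close>
  moreover have "\<forall>\<^sub>F n in sequentially. 2 * (real K * real n + 1) \<le> exp (\<eta> / 2 * real n)"
    using \<eta> by real_asymp
  ultimately show ?thesis
  proof eventually_elim
    case (elim n)
    define u where "u = (\<lambda>k. if k \<le> K then w k else 0)"
    obtain D where D: "D \<le> K * n"
      "\<And>x. (\<Sum>M\<le>D. Z u M n * exp ((real M - l * real n) * x)) = H x ^ n"
      using Z_truncated_sum[of K n w l] unfolding u_def H_def by blast
    define A where "A = (\<lambda>x M. Z u M n * exp ((real M - l * real n) * x))"
    have A_nn: "0 \<le> A x M" for x M by (simp add: A_def u_def nn Z_nonneg)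
    have u_le: "Z u M n \<le> Z w M n" for M by (rule Z_mono) (auto simp: u_def nn)
    have "\<exists>M. \<bar>real M - l * real n\<bar> \<le> \<epsilon>' * real n \<and> (V * exp (- \<eta>)) ^ n \<le> Z w M n"
    proof (rule ccontr)
      assume neg: "\<not> ?thesis"
      define a where "a = h ^ n * exp (- \<eta> / 2 * real n)"
      have a: "0 \<le> a" using hV by (simp add: a_def)
      \<comment> \<open>Window, lower tail and upper tail each supply one summand, so the bound
        holds for every \<open>M\<close> and can be summed.\<close>
      have "A x0 M \<le> a + A x1 M * exp (- \<epsilon>' * y1) ^ n + A x2 M * exp (- \<epsilon>' * y2) ^ n" for M
      proof -
        consider "\<bar>real M - l * real n\<bar> \<le> \<epsilon>' * real n" | "real M - l * real n > \<epsilon>' * real n"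
          | "real M - l * real n < - (\<epsilon>' * real n)" by linarith
        then show ?thesis
        proof cases
          case 1
          with neg have "Z w M n < (V * exp (- \<eta>)) ^ n" by auto
          then have "Z u M n \<le> (h * exp (- \<eta>)) ^ n"
            using u_le[of M] power_mono[of "V * exp (- \<eta>)" "h * exp (- \<eta>)" n] hV V(1) by force
          moreover have "(real M - l * real n) * x0 \<le> \<eta> / 2 * real n"
          proof -
            have "(real M - l * real n) * x0 \<le> \<bar>real M - l * real n\<bar> * \<bar>x0\<bar>"
              by (metis abs_ge_self abs_mult)
            also have "\<dots> \<le> \<epsilon>' * real n * \<bar>x0\<bar>" using 1 by (intro mult_right_mono) auto
            also have "\<dots> \<le> \<eta> / 2 * real n"
              using mult_right_mono[OF \<epsilon>'(3), of "real n"] by (simp add: mult_ac)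
            finally show ?thesis .
          qed
          ultimately have "A x0 M \<le> (h * exp (- \<eta>)) ^ n * exp (\<eta> / 2 * real n)"
            unfolding A_def using hV by (intro mult_mono) auto
          also have "\<dots> = a"
            by (simp add: a_def power_mult_distrib exp_of_nat_mult[symmetric] exp_add[symmetric] algebra_simps)
          finally show ?thesis using A_nn by (simp add: add_increasing2)
        next
          case 2
          have "(real M - l * real n) * x0 = (real M - l * real n) * x2 + (- (real M - l * real n) * y2)"
            by (simp add: x2_def algebra_simps)
          also have "\<dots> \<le> (real M - l * real n) * x2 + real n * (- \<epsilon>' * y2)"
            using mult_right_mono[of "\<epsilon>' * real n" "real M - l * real n" y2] 2 y by (simp add: algebra_simps)
          finally have "exp ((real M - l * real n) * x0)
              \<le> exp ((real M - l * real n) * x2) * exp (- \<epsilon>' * y2) ^ n"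
            unfolding exp_of_nat_mult[symmetric] exp_add[symmetric] by (simp only: exp_le_cancel_iff)
          then have "A x0 M \<le> A x2 M * exp (- \<epsilon>' * y2) ^ n"
            unfolding A_def mult.assoc by (intro mult_left_mono) (auto simp: u_def nn Z_nonneg)
          then show ?thesis using a A_nn[of x1 M] by (simp add: add_increasing)
        next
          case 3
          have "(real M - l * real n) * x0 = (real M - l * real n) * x1 + (real M - l * real n) * y1"
            by (simp add: x1_def algebra_simps)
          also have "\<dots> \<le> (real M - l * real n) * x1 + real n * (- \<epsilon>' * y1)"
            using mult_right_mono[of "real M - l * real n" "- (\<epsilon>' * real n)" y1] 3 y by (simp add: algebra_simps)
          finally have "exp ((real M - l * real n) * x0)
              \<le> exp ((real M - l * real n) * x1) * exp (- \<epsilon>' * y1) ^ n"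
            unfolding exp_of_nat_mult[symmetric] exp_add[symmetric] by (simp only: exp_le_cancel_iff)
          then have "A x0 M \<le> A x1 M * exp (- \<epsilon>' * y1) ^ n"
            unfolding A_def mult.assoc by (intro mult_left_mono) (auto simp: u_def nn Z_nonneg)
          then show ?thesis using a A_nn[of x2 M] by (simp add: add_increasing add_increasing2)
        qed
      qed
      then have "(\<Sum>M\<le>D. A x0 M) \<le> (\<Sum>M\<le>D. a + A x1 M * exp (- \<epsilon>' * y1) ^ n + A x2 M * exp (- \<epsilon>' * y2) ^ n)"
        by (intro sum_mono)
      also have "\<dots> = (real D + 1) * a + H x1 ^ n * exp (- \<epsilon>' * y1) ^ n + H x2 ^ n * exp (- \<epsilon>' * y2) ^ n"
        by (simp add: sum.distrib sum_distrib_right[symmetric] A_def D(2))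
      also have "H x1 ^ n * exp (- \<epsilon>' * y1) ^ n = q1 ^ n * h ^ n"
        using hV by (simp add: q1_def power_divide power_mult_distrib)
      also have "H x2 ^ n * exp (- \<epsilon>' * y2) ^ n = q2 ^ n * h ^ n"
        using hV by (simp add: q2_def power_divide power_mult_distrib)
      also have "(\<Sum>M\<le>D. A x0 M) = h ^ n" by (simp add: A_def D(2) h_def)
      finally have sum_le: "h ^ n \<le> (real D + 1) * a + q1 ^ n * h ^ n + q2 ^ n * h ^ n" .
      have "real D \<le> real K * real n" using D(1) by (metis of_nat_le_iff of_nat_mult)
      then have "(real D + 1) * a \<le> exp (\<eta> / 2 * real n) / 2 * a"
        using elim(3) a by (intro mult_right_mono) auto
      also have "\<dots> = h ^ n / 2" by (simp add: a_def exp_minus field_simps)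
      finally have "(real D + 1) * a \<le> h ^ n / 2" .
      \<comment> \<open>At most one half from the window and less than one quarter from each tail
        cannot add up to all of \<open>h ^ n\<close>.\<close>
      moreover have "q1 ^ n * h ^ n < 1 / 4 * h ^ n" "q2 ^ n * h ^ n < 1 / 4 * h ^ n"
        using elim hV by (auto intro!: mult_strict_right_mono)
      ultimately show False using sum_le by linarith
    qed
    moreover have "\<epsilon>' * real n \<le> \<epsilon> * real n" using \<epsilon>' by (intro mult_right_mono) auto
    ultimately show ?case using order_trans by blast
  qed
qed

section \<open>Reaching the prescribed number of balls exactly\<close>

text \<open>Filling boxes with 0 or \<open>b\<close> balls changes a total by multiples of
  \<open>b\<close> only, so the residue modulo \<open>b\<close> has to be corrected first. There are
  finitely many attainable residues, hence boundedly many balls in a fixed number \<open>r0\<close>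
  of boxes suffice, with weight bounded below.\<close>

lemma Z_residue_representatives:
  fixes w :: "nat \<Rightarrow> real"
  assumes nn: "\<And>k. 0 \<le> w k" and w0: "0 < w 0" and b: "0 < b"
  shows "\<exists>R0 r0 c. 0 < c \<and> (\<forall>x nx y ny. 0 < Z w x nx \<longrightarrow> 0 < Z w y ny \<longrightarrow>
      (\<exists>R\<le>R0. c \<le> Z w R r0 \<and> (y + R) mod b = x mod b))"
proof -
  define T where "T = (\<lambda>R. R mod b) ` {R. \<exists>r. 0 < Z w R r}"
  have "T \<subseteq> {..<b}" using b by (auto simp: T_def)
  then have fin: "finite T" using finite_subset by blast
  have "0 < Z w 0 0" by simp
  then have ne: "T \<noteq> {}" unfolding T_def by blast
  have "\<forall>e\<in>T. \<exists>R r. 0 < Z w R r \<and> R mod b = e" by (auto simp: T_def)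
  then obtain f g where fg: "\<And>e. e \<in> T \<Longrightarrow> 0 < Z w (f e) (g e) \<and> f e mod b = e" by metis
  \<comment> \<open>Empty boxes pad every representative to this common number of boxes.\<close>
  define r0 where "r0 = sum g T"
  define c where "c = Min ((\<lambda>e. Z w (f e) r0) ` T)"
  have pos: "0 < Z w (f e) r0" if "e \<in> T" for e
  proof -
    have "g e \<le> r0" unfolding r0_def using fin that by (intro member_le_sum) auto
    then show ?thesis using Z_pos_add[of w "f e" "g e" "r0 - g e"] nn w0 fg[OF that] by simp
  qed
  have c: "0 < c" using fin ne pos by (auto simp: c_def)
  have "\<exists>R\<le>sum f T. c \<le> Z w R r0 \<and> (y + R) mod b = x mod b"
    if xy: "0 < Z w x nx" "0 < Z w y ny" for x nx y ny
  proof -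
    \<comment> \<open>The residues form a group because \<open>(b - 1) y\<close> is inverse to \<open>y\<close>.\<close>
    have "0 < Z w x nx * Z w y ny ^ (b - 1)" using xy by simp
    also have "\<dots> \<le> Z w x nx * Z w ((b - 1) * y) ((b - 1) * ny)"
      using xy by (intro mult_left_mono Z_mult_ge nn) auto
    also have "\<dots> \<le> Z w (x + (b - 1) * y) (nx + (b - 1) * ny)" by (rule Z_add_ge[OF nn])
    finally have e: "(x + (b - 1) * y) mod b \<in> T" (is "?e \<in> T") by (auto simp: T_def)
    have "(y + f ?e) mod b = (y + (x + (b - 1) * y)) mod b"
      using fg[OF e] by (metis mod_add_right_eq)
    also have "y + (x + (b - 1) * y) = x + y * b" using b by (cases b) (auto simp: algebra_simps)
    finally have "(y + f ?e) mod b = x mod b" by simp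
    moreover have "f ?e \<le> sum f T" using fin e by (intro member_le_sum) auto
    moreover have "c \<le> Z w (f ?e) r0" unfolding c_def using fin e by (intro Min_le) auto
    ultimately show ?thesis by blast
  qed
  with c show ?thesis by blast
qed

text \<open>\<open>q\<close> boxes get \<open>b\<close> balls and the others none; whatever
  \<open>q\<close> is, each box contributes at least \<open>c1\<close>.\<close>

lemma Z_fill:
  assumes nn: "\<And>k. 0 \<le> w k" and c1: "0 \<le> c1" "c1 \<le> 1" "c1 \<le> w 0" "c1 \<le> w b" and q: "q \<le> d"
  shows "c1 ^ d \<le> Z w (b * q) d"
proof -
  have "c1 ^ d = c1 ^ q * c1 ^ (d - q)" using q by (simp flip: power_add)
  also have "\<dots> \<le> w b ^ q * w 0 ^ (d - q)"
    using c1 nn by (intro mult_mono power_mono) auto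
  also have "\<dots> \<le> Z w (q * b) (q * 1) * Z w ((d - q) * 0) ((d - q) * 1)"
    using Z_mult_ge[of w b 1 q] Z_mult_ge[of w 0 1 "d - q"] nn
    unfolding Z_single by (intro mult_mono Z_nonneg) auto
  also have "\<dots> \<le> Z w (q * b) d"
    using Z_add_ge[of w "q * b" q 0 "d - q"] nn q by simp
  finally show ?thesis by (simp add: mult.commute)
qed

text \<open>The boxes form three groups: \<open>n - d\<close> carry some \<open>M\<close> near
  \<open>l * (n - d)\<close> with large weight, \<open>r0\<close> carry the residue correction
  \<open>R\<close>, and \<open>d - r0\<close> are filled with 0 or \<open>b\<close> balls. Since
  \<open>0 < l < b\<close>, the last group can absorb the deviations of \<open>m\<close> and
  \<open>M\<close>. Positivity of \<open>Z w (m n) n\<close> makes the required residue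
  attainable.\<close>

lemma Z_lower_bound:
  fixes w :: "nat \<Rightarrow> real" and m :: "nat \<Rightarrow> nat"
  assumes nn: "\<And>k. 0 \<le> w k" and w0: "0 < w 0" and wb: "0 < w b"
    and l: "0 < l" "l < real b" and V0: "0 < V"
    and V: "\<And>x. summable (\<lambda>k. w k * exp ((real k - l) * x)) \<Longrightarrow> V \<le> (\<Sum>k. w k * exp ((real k - l) * x))"
    and mn: "(\<lambda>n. real (m n) / real n) \<longlonglongrightarrow> l" and \<eta>: "0 < \<eta>"
  shows "\<forall>\<^sub>F n in sequentially. 0 < Z w (m n) n \<longrightarrow> (V * exp (- \<eta>)) ^ n \<le> Z w (m n) n"
proof -
  \<comment> \<open>Budget for \<open>\<eta>\<close>: a quarter each for truncation
    (\<open>V1\<close>), concentration (\<open>V2\<close>), the \<open>d\<close> spare boxes, and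
    the constant \<open>c\<close>.\<close>
  define V1 where "V1 = V * exp (- \<eta> / 4)"
  define V2 where "V2 = V1 * exp (- \<eta> / 4)"
  have V12: "0 < V1" "V1 < V" "0 < V2" using V0 \<eta> by (auto simp: V1_def V2_def)
  have V2_eq: "V2 * exp (- \<eta> / 2) = V * exp (- \<eta>)"
    by (simp add: V1_def V2_def mult.assoc exp_add[symmetric])
  obtain K where K: "b \<le> K" "\<And>x. V1 \<le> (\<Sum>k\<le>K. w k * exp ((real k - l) * x))"
    using truncation_lower_bound[where w = w and b = b, OF nn w0 wb l V V12(2)] by blast
  have b: "0 < b" using l by (cases b) auto
  obtain R0 r0 c where c: "0 < c" and R: "\<And>x nx y ny. 0 < Z w x nx \<Longrightarrow> 0 < Z w y ny \<Longrightarrow>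
      \<exists>R\<le>R0. c \<le> Z w R r0 \<and> (y + R) mod b = x mod b"
    using Z_residue_representatives[of w b] nn w0 b by metis
  define c1 where "c1 = min 1 (min (w 0) (w b))"
  have c1: "0 < c1" "c1 \<le> 1" "c1 \<le> w 0" "c1 \<le> w b" using w0 wb by (auto simp: c1_def)
  \<comment> \<open>\<open>C\<close> bounds \<open>\<bar>ln (c1 / V2)\<bar>\<close>, the cost per
    box of having \<open>c1\<close> in place of \<open>V2\<close>; \<open>\<delta>\<close> is chosen
    so that at most \<open>2 * \<delta> * n\<close> such boxes cost at most
    \<open>\<eta> * n / 4\<close> in the exponent.\<close>
  define C where "C = \<bar>ln V2\<bar> + \<bar>ln c1\<bar>"
  have C: "0 \<le> C" by (simp add: C_def)
  define \<delta> where "\<delta> = min (1 / 2) (\<eta> / (8 * (C + 1)))"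
  have \<delta>: "0 < \<delta>" "\<delta> \<le> 1 / 2"
    using \<eta> C min.cobounded1[of "1 / 2"] by (auto simp only: \<delta>_def) simp
  have "C * \<delta> \<le> (C + 1) * (\<eta> / (8 * (C + 1)))"
    using C \<delta> by (intro mult_mono) (auto simp: \<delta>_def)
  also have "\<dots> = \<eta> / 8" using C by (simp add: field_simps)
  finally have C\<delta>: "C * \<delta> \<le> \<eta> / 8" .
  \<comment> \<open>\<open>\<mu>\<close> is the distance of \<open>l\<close> from the ends of the
    interval from 0 to \<open>b\<close>. With \<open>\<epsilon>\<close> as below, the two deviations
    together use at most \<open>\<mu> * d / 2\<close>, leaving slack for \<open>R0\<close> and
    \<open>r0\<close>.\<close>
  define \<mu> where "\<mu> = min l (real b - l)"
  have \<mu>: "0 < \<mu>" "\<mu> \<le> l" "\<mu> \<le> real b - l" using l by (auto simp: \<mu>_def)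
  define \<epsilon> where "\<epsilon> = \<delta> * \<mu> / 4"
  have \<epsilon>: "0 < \<epsilon>" using \<delta> \<mu> by (simp add: \<epsilon>_def)
  define d where "d = (\<lambda>n. nat \<lceil>\<delta> * real n\<rceil>)"
  have near: "\<forall>\<^sub>F n in sequentially. \<exists>M. \<bar>real M - l * real n\<bar> \<le> \<epsilon> * real n \<and> V2 ^ n \<le> Z w M n"
    using Z_concentration_lower_bound[where w = w and b = b and \<eta> = "\<eta> / 4", OF nn w0 wb l K(1) V12(1) K(2) \<epsilon>] \<eta>
    by (simp add: V2_def)
  have dn: "\<delta> * real n \<le> real (d n)" "real (d n) \<le> \<delta> * real n + 1" for n
    using \<delta> by (auto simp: d_def)
  \<comment> \<open>\<open>\<delta> \<le> 1 / 2\<close> keeps \<open>n - d n\<close> growing, so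
    concentration applies with \<open>n - d n\<close> boxes.\<close>
  have lim: "filterlim (\<lambda>n. n - d n) at_top sequentially"
    unfolding filterlim_at_top
  proof
    fix X :: nat
    have "\<forall>\<^sub>F n in sequentially. real X + 1 \<le> (1 - \<delta>) * real n"
    proof -
      have "0 < 1 - \<delta>" using \<delta> by simp
      then show ?thesis by real_asymp
    qed
    then show "\<forall>\<^sub>F n in sequentially. X \<le> n - d n"
    proof eventually_elim
      case (elim n)
      then show ?case using dn(2)[of n] by (simp add: algebra_simps)
    qed
  qed
  have near': "\<forall>\<^sub>F n in sequentially. \<exists>M. \<bar>real M - l * real (n - d n)\<bar> \<le> \<epsilon> * real (n - d n)
      \<and> V2 ^ (n - d n) \<le> Z w M (n - d n)"
    using eventually_compose_filterlim[OF near lim] .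
  have e1: "\<forall>\<^sub>F n in sequentially. \<bar>real (m n) / real n - l\<bar> < \<epsilon>"
    using tendstoD[OF mn \<epsilon>] by (simp add: dist_real_def)
  have e2: "\<forall>\<^sub>F n in sequentially. 2 \<le> \<delta> * real n" "\<forall>\<^sub>F n in sequentially. real r0 \<le> \<delta> * real n"
    using \<delta>(1) by real_asymp+
  have e3: "\<forall>\<^sub>F n in sequentially. real R0 \<le> l / 2 * (\<delta> * real n)"
    using \<delta>(1) l(1) by real_asymp
  have "0 < real b - l" using l by simp
  then have e4: "\<forall>\<^sub>F n in sequentially. real b * real r0 \<le> (real b - l) / 2 * (\<delta> * real n)"
    using \<delta>(1) by real_asymp
  have e5: "\<forall>\<^sub>F n in sequentially. exp (- \<eta> / 4 * real n) \<le> c"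
    using \<eta> c by real_asymp
  show ?thesis
    using near' e1 e2 e3 e4 e5 eventually_gt_at_top[of 0]
  proof (eventually_elim, intro impI)
    fix n
    assume near: "\<exists>M. \<bar>real M - l * real (n - d n)\<bar> \<le> \<epsilon> * real (n - d n) \<and> V2 ^ (n - d n) \<le> Z w M (n - d n)"
      and mn: "\<bar>real (m n) / real n - l\<bar> < \<epsilon>" and n2: "2 \<le> \<delta> * real n" and nr0: "real r0 \<le> \<delta> * real n"
      and nR0: "real R0 \<le> l / 2 * (\<delta> * real n)"
      and nb: "real b * real r0 \<le> (real b - l) / 2 * (\<delta> * real n)"
      and nc: "exp (- \<eta> / 4 * real n) \<le> c" and n0: "0 < n" and pos: "0 < Z w (m n) n"
    obtain M where M: "\<bar>real M - l * real (n - d n)\<bar> \<le> \<epsilon> * real (n - d n)" "V2 ^ (n - d n) \<le> Z w M (n - d n)"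
      using near by blast
    have d2: "real (d n) \<le> 2 * (\<delta> * real n)" using dn(2)[of n] n2 by linarith
    also have "\<dots> \<le> 1 * real n"
      using mult_right_mono[OF \<delta>(2), of "real n"] by simp
    finally have d_le: "d n \<le> n" by simp
    have Mpos: "0 < Z w M (n - d n)" using M(2) V12(3) by (meson less_le_trans zero_less_power)
    obtain R where R: "R \<le> R0" "c \<le> Z w R r0" "(M + R) mod b = m n mod b"
      using R[OF pos Mpos] by blast
    have x: "\<bar>real (m n) - l * real n\<bar> \<le> \<epsilon> * real n"
    proof -
      have "real (m n) - l * real n = (real (m n) / real n - l) * real n" using n0 by (simp add: field_simps)
      then have "\<bar>real (m n) - l * real n\<bar> = \<bar>real (m n) / real n - l\<bar> * real n" by (simp add: abs_mult)
      also have "\<dots> \<le> \<epsilon> * real n" using mn by (intro mult_right_mono) auto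
      finally show ?thesis .
    qed
    have M': "\<bar>real M - (l * real n - l * real (d n))\<bar> \<le> \<epsilon> * real n"
    proof -
      have "l * real (n - d n) = l * real n - l * real (d n)" using d_le by (simp add: of_nat_diff algebra_simps)
      moreover have "\<epsilon> * real (n - d n) \<le> \<epsilon> * real n" using \<epsilon> by (intro mult_left_mono) auto
      ultimately show ?thesis using M(1) by simp
    qed
    have "2 * (\<epsilon> * real n) = \<mu> / 2 * (\<delta> * real n)" by (simp add: \<epsilon>_def)
    also have "\<dots> \<le> \<mu> / 2 * real (d n)" using dn(1)[of n] \<mu> by (intro mult_left_mono) auto
    finally have e: "2 * (\<epsilon> * real n) \<le> \<mu> / 2 * real (d n)" .
    \<comment> \<open>Enough balls remain for the residue correction; \<open>hi\<close> below says
      that the remaining balls fit into \<open>d n - r0\<close> boxes of size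
      \<open>b\<close>.\<close>
    have lo: "real M + real R0 \<le> real (m n)"
    proof -
      have "\<mu> / 2 * real (d n) \<le> l / 2 * real (d n)" using \<mu> by (intro mult_right_mono) auto
      moreover have "real R0 \<le> l / 2 * real (d n)"
        using nR0 mult_left_mono[OF dn(1)[of n], of "l / 2"] l by linarith
      ultimately show ?thesis using x M' e by linarith
    qed
    have hi: "real (m n) - real M \<le> real b * (real (d n) - real r0)"
    proof -
      have "\<mu> / 2 * real (d n) \<le> (real b - l) / 2 * real (d n)" using \<mu> by (intro mult_right_mono) auto
      moreover have "real b * real r0 \<le> (real b - l) / 2 * real (d n)"
        by (rule order_trans[OF nb], rule mult_left_mono[OF dn(1)]) (use l in simp)
      moreover have "(real b - l) / 2 * real (d n) = (real b * real (d n) - l * real (d n)) / 2"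
        by (simp add: left_diff_distrib)
      ultimately show ?thesis using x M' e by (simp add: right_diff_distrib)
    qed
    have MR: "M + R \<le> m n" using lo R(1) by linarith
    have r0_le: "r0 \<le> d n" using nr0 dn(1)[of n] by linarith
    have "b dvd m n - (M + R)" using R(3) MR by (metis mod_eq_dvd_iff_nat)
    then obtain q where q: "m n - (M + R) = b * q" by blast
    have "real (b * q) \<le> real (b * (d n - r0))"
    proof -
      have "real (b * q) = real (m n) - real M - real R" using q MR by linarith
      also have "\<dots> \<le> real b * (real (d n) - real r0)" using hi by linarith
      finally show ?thesis using r0_le by (simp add: of_nat_diff)
    qed
    then have qd: "q \<le> d n - r0" using b by (simp only: of_nat_le_iff) simp
    have "V2 ^ (n - d n) * (c * c1 ^ d n) \<le> Z w M (n - d n) * (Z w R r0 * Z w (b * q) (d n - r0))"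
    proof (intro mult_mono M(2) R(2))
      have "c1 ^ d n \<le> c1 ^ (d n - r0)" using c1 by (intro power_decreasing) auto
      also have "\<dots> \<le> Z w (b * q) (d n - r0)" using c1 qd by (intro Z_fill nn) auto
      finally show "c1 ^ d n \<le> Z w (b * q) (d n - r0)" .
    qed (use c c1 V12 in \<open>auto intro!: mult_nonneg_nonneg Z_nonneg nn\<close>)
    also have "\<dots> \<le> Z w M (n - d n) * Z w (R + b * q) (r0 + (d n - r0))"
      by (intro mult_left_mono Z_add_ge Z_nonneg nn)
    also have "\<dots> \<le> Z w (M + (R + b * q)) (n - d n + (r0 + (d n - r0)))"
      by (rule Z_add_ge[OF nn])
    also have "M + (R + b * q) = m n" using q MR by linarith
    also have "n - d n + (r0 + (d n - r0)) = n" using r0_le d_le by linarith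
    finally have main: "V2 ^ (n - d n) * (c * c1 ^ d n) \<le> Z w (m n) n" .
    have "V2 ^ n * exp (- \<eta> / 4 * real n) \<le> V2 ^ (n - d n) * c1 ^ d n"
    proof -
      have "C * real (d n) \<le> C * (2 * (\<delta> * real n))" using d2 C by (intro mult_left_mono)
      also have "\<dots> \<le> \<eta> / 4 * real n" using mult_right_mono[OF C\<delta>, of "real n"] by simp
      finally have "- \<eta> / 4 * real n \<le> real (d n) * - C" by (simp add: mult.commute)
      also have "\<dots> \<le> real (d n) * (ln c1 - ln V2)" by (intro mult_left_mono) (auto simp: C_def)
      finally have "exp (- \<eta> / 4 * real n) \<le> exp (real (d n) * (ln c1 - ln V2))" by simp
      also have "\<dots> = (c1 / V2) ^ d n" using c1 V12 by (simp only: exp_of_nat_mult exp_diff exp_ln)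
      finally have "V2 ^ n * exp (- \<eta> / 4 * real n) \<le> V2 ^ n * (c1 / V2) ^ d n"
        using V12 by (intro mult_left_mono) auto
      also have "\<dots> = V2 ^ (n - d n) * c1 ^ d n"
        using V12 d_le by (simp add: power_divide power_diff)
      finally show ?thesis .
    qed
    then have "V2 ^ n * exp (- \<eta> / 4 * real n) * exp (- \<eta> / 4 * real n) \<le> V2 ^ (n - d n) * c1 ^ d n * c"
      by (rule mult_mono[OF _ nc]) (use c1 V12 in auto)
    moreover have "(V * exp (- \<eta>)) ^ n = V2 ^ n * exp (- \<eta> / 4 * real n) * exp (- \<eta> / 4 * real n)"
    proof -
      have "exp (- \<eta> / 2) ^ n = exp (- \<eta> / 4 * real n) * exp (- \<eta> / 4 * real n)"
        by (simp add: exp_of_nat_mult[symmetric] exp_add[symmetric] field_simps)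
      then show ?thesis by (simp add: V2_eq[symmetric] power_mult_distrib)
    qed
    ultimately show "(V * exp (- \<eta>)) ^ n \<le> Z w (m n) n"
      using main by (simp add: mult_ac)
  qed
qed

text \<open>\<open>V\<close> below is the minimum of \<Phi>(t) divided by \<open>t powr l\<close>,
  attained at \<open>T\<close>, so \<open>Z_lower_bound\<close> gives nearly \<open>V ^ n\<close>.
  As \<open>m\<close> is close to \<open>l * n\<close>, multiplying by \<open>T ^ m\<close> restores
  \<open>P ^ n\<close> up to a factor of small exponential rate.\<close>

lemma Z_ratio_tendsto_minimum:
  fixes w :: "nat \<Rightarrow> real" and m :: "nat \<Rightarrow> nat"
  assumes nn: "\<And>k. 0 \<le> w k" and w0: "0 < w 0" and wb: "0 < w b"
    and l: "0 < l" "l < real b" and T: "0 < T" and sm: "summable (\<lambda>k. w k * T ^ k)"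
    and min: "\<And>t. 0 < t \<Longrightarrow> summable (\<lambda>k. w k * t ^ k) \<Longrightarrow>
        (\<Sum>k. w k * T ^ k) * T powr - l \<le> (\<Sum>k. w k * t ^ k) * t powr - l"
    and mn: "(\<lambda>n. real (m n) / real n) \<longlonglongrightarrow> l"
  shows "((\<lambda>n. Z w (m n) (Suc n) / Z w (m n) n) \<longlongrightarrow> (\<Sum>k. w k * T ^ k))
    (inf sequentially (principal {n. 0 < Z w (m n) n}))"
proof -
  define P where "P = (\<Sum>k. w k * T ^ k)"
  define V where "V = P * T powr - l"
  have "w 0 * T ^ 0 \<le> P"
    unfolding P_def using sum_le_suminf[OF sm, of "{0}"] nn T by simp
  then have P: "0 < P" using w0 by simp
  have V0: "0 < V" using P T by (simp add: V_def)
  have V: "V \<le> (\<Sum>k. w k * exp ((real k - l) * x))"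
    if "summable (\<lambda>k. w k * exp ((real k - l) * x))" for x
  proof -
    have e: "w k * exp ((real k - l) * x) = exp (- l * x) * (w k * exp x ^ k)" for k
      by (simp add: exp_of_nat_mult[symmetric] exp_add[symmetric] algebra_simps)
    have s: "summable (\<lambda>k. w k * exp x ^ k)"
      using that unfolding e by (simp add: summable_cmult_iff)
    have "V \<le> (\<Sum>k. w k * exp x ^ k) * exp x powr - l"
      using min[OF _ s] by (simp add: V_def P_def)
    also have "\<dots> = (\<Sum>k. w k * exp ((real k - l) * x))"
      unfolding e suminf_mult[OF s] by (simp add: powr_def)
    finally show ?thesis .
  qed
  show ?thesis unfolding P_def[symmetric]
  proof (rule Z_ratio_tendsto_of_lower_bound[where w = w and m = m, OF nn w0 P T])
    show "Z w M N * T ^ M \<le> P ^ N" for M N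
      unfolding P_def using T sm nn by (intro Z_power_le) auto
    fix \<eta> :: real assume \<eta>: "0 < \<eta>"
    \<comment> \<open>With \<open>\<bar>m / n - l\<bar> < \<epsilon>\<close>, the quantity
      \<open>T powr (m - l * n)\<close> is at least \<open>exp (- \<eta> * n / 2)\<close>; the
      \<open>+ 1\<close> covers \<open>T = 1\<close>.\<close>
    define \<epsilon> where "\<epsilon> = \<eta> / (2 * (\<bar>ln T\<bar> + 1))"
    have \<epsilon>: "0 < \<epsilon>" using \<eta> by (simp add: \<epsilon>_def)
    have "\<epsilon> * \<bar>ln T\<bar> \<le> \<eta> / (2 * (\<bar>ln T\<bar> + 1)) * (\<bar>ln T\<bar> + 1)"
      unfolding \<epsilon>_def using \<eta> by (intro mult_left_mono) auto
    also have "\<dots> = \<eta> / 2" by (simp add: field_simps)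
    finally have \<epsilon>T: "\<epsilon> * \<bar>ln T\<bar> \<le> \<eta> / 2" .
    have "\<forall>\<^sub>F n in sequentially. 0 < Z w (m n) n \<longrightarrow> (V * exp (- (\<eta> / 2))) ^ n \<le> Z w (m n) n"
      using \<eta> by (intro Z_lower_bound[where w = w and m = m and b = b, OF nn w0 wb l V0 V mn]) auto
    moreover have "\<forall>\<^sub>F n in sequentially. \<bar>real (m n) / real n - l\<bar> < \<epsilon>"
      using tendstoD[OF mn \<epsilon>] by (simp add: dist_real_def)
    ultimately show "\<forall>\<^sub>F n in sequentially.
        0 < Z w (m n) n \<longrightarrow> exp (- \<eta> * real n) * P ^ n \<le> Z w (m n) n * T ^ m n"
      using eventually_gt_at_top[of 0]
    proof (eventually_elim, intro impI)
      fix n assume n: "0 < Z w (m n) n \<longrightarrow> (V * exp (- (\<eta> / 2))) ^ n \<le> Z w (m n) n"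
        "\<bar>real (m n) / real n - l\<bar> < \<epsilon>" "0 < n" "0 < Z w (m n) n"
      define y where "y = real n * (real (m n) / real n - l)"
      have "\<bar>y * ln T\<bar> = real n * (\<bar>real (m n) / real n - l\<bar> * \<bar>ln T\<bar>)"
        by (simp add: y_def abs_mult)
      also have "\<dots> \<le> real n * (\<epsilon> * \<bar>ln T\<bar>)" using n by (intro mult_left_mono mult_right_mono) auto
      also have "\<dots> \<le> real n * (\<eta> / 2)" using \<epsilon>T by (intro mult_left_mono) auto
      finally have y: "- (\<eta> / 2 * real n) \<le> y * ln T" by (simp add: mult.commute abs_le_iff)
      have "exp (- \<eta> * real n) = exp (- (\<eta> / 2 * real n)) * exp (- (\<eta> / 2 * real n))"
        by (simp add: exp_add[symmetric])
      also have "\<dots> \<le> exp (- (\<eta> / 2 * real n)) * exp (y * ln T)" using y by simp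
      also have "exp (y * ln T) = (T powr - l) ^ n * T ^ m n"
      proof -
        have "T ^ m n = exp (real (m n) * ln T)" using T by (simp add: exp_of_nat_mult)
        moreover have "(T powr - l) ^ n = exp (real n * (- l * ln T))"
          using T by (simp only: exp_of_nat_mult) (simp add: powr_def)
        moreover have "y * ln T = real n * (- l * ln T) + real (m n) * ln T"
          using n(3) by (simp add: y_def left_diff_distrib right_diff_distrib)
        ultimately show ?thesis by (simp only: exp_add)
      qed
      finally have "exp (- \<eta> * real n) * P ^ n
          \<le> exp (- (\<eta> / 2 * real n)) * ((T powr - l) ^ n * T ^ m n) * P ^ n"
        using P by (intro mult_right_mono) auto
      also have "\<dots> = (V * exp (- (\<eta> / 2))) ^ n * T ^ m n"
      proof -
        have "exp (- (\<eta> / 2 * real n)) = exp (- (\<eta> / 2)) ^ n"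
          by (simp add: exp_of_nat_mult[symmetric] mult.commute)
        then show ?thesis by (simp add: V_def power_mult_distrib mult_ac)
      qed
      also have "\<dots> \<le> Z w (m n) n * T ^ m n" using n T by (intro mult_right_mono) auto
      finally show "exp (- \<eta> * real n) * P ^ n \<le> Z w (m n) n * T ^ m n" .
    qed
  qed
qed

section \<open>The parameter \<open>\<tau>\<close> as a minimiser\<close>

text \<open>Real-valued \<Phi>, meaningful only where the series converges; hence the summability
  facts that accompany it.\<close>

definition gf :: "(nat \<Rightarrow> real) \<Rightarrow> real \<Rightarrow> real" where
  "gf w t = (\<Sum>k. w k * t ^ k)"

text \<open>\<open>t \<Phi>'(t)\<close>\<close>
definition gf1 :: "(nat \<Rightarrow> real) \<Rightarrow> real \<Rightarrow> real" where
  "gf1 w t = (\<Sum>k. real k * w k * t ^ k)"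

locale weight_sequence =
  fixes w :: "nat \<Rightarrow> real"
  assumes nn: "\<And>k. 0 \<le> w k" and w0: "0 < w 0" and wk: "\<exists>k\<ge>1. 0 < w k"
begin

abbreviation "sm t \<equiv> summable (\<lambda>k. w k * t ^ k)"
abbreviation "sm1 t \<equiv> summable (\<lambda>k. real k * w k * t ^ k)"

section \<open>Convergence of the series and values of \<Psi>\<close>

lemma sm1_imp_sm: assumes "0 \<le> t" "sm1 t" shows "sm t"
proof (rule summable_comparison_test'[OF assms(2), of 1])
  fix k :: nat assume "1 \<le> k"
  then have "1 * (w k * t ^ k) \<le> real k * (w k * t ^ k)"
    using nn assms by (intro mult_right_mono) auto
  then show "norm (w k * t ^ k) \<le> real k * w k * t ^ k" using nn assms by (simp add: mult.assoc)
qed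

lemma sm_below: assumes "0 \<le> t" "ereal t < rho w" shows "sm t" "sm1 t"
proof -
  show "sm t" using assms by (intro summable_in_conv_radius) (simp add: rho_def)
  obtain K where K: "ereal t < ereal K" "ereal K < rho w" using ereal_dense2[OF assms(2)] by blast
  have "summable (\<lambda>k. diffs w k * t ^ k)"
  proof (rule termdiff_converges)
    show "norm t < K" using K assms by simp
    show "summable (\<lambda>k. w k * x ^ k)" if "norm x < K" for x
      using that less_trans[of "ereal (norm x)" "ereal K"] K
      by (intro summable_in_conv_radius) (simp add: rho_def)
  qed
  then have "summable (\<lambda>k. t * (diffs w k * t ^ k))" by (rule summable_mult)
  then have "summable (\<lambda>k. real (Suc k) * w (Suc k) * t ^ Suc k)" by (simp add: diffs_def mult_ac)
  then show "sm1 t" by (simp only: summable_Suc_iff[of "\<lambda>k. real k * w k * t ^ k"])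
qed

lemma sm_imp_le_rho: "0 \<le> t \<Longrightarrow> sm t \<Longrightarrow> ereal t \<le> rho w"
  using conv_radius_geI[of w t] by (simp add: rho_def)

lemma gf_pos: assumes "0 \<le> t" "sm t" shows "0 < gf w t"
proof -
  have "(\<Sum>k\<in>{0}. w k * t ^ k) \<le> gf w t"
    unfolding gf_def using assms nn by (intro sum_le_suminf) auto
  then show ?thesis using w0 by simp
qed

lemma gf1_pos: assumes "0 < t" "sm1 t" shows "0 < gf1 w t"
proof -
  obtain k where k: "1 \<le> k" "0 < w k" using wk by blast
  have "(\<Sum>k\<in>{k}. real k * w k * t ^ k) \<le> gf1 w t"
    unfolding gf1_def using assms nn by (intro sum_le_suminf) auto
  moreover have "0 < real k * w k * t ^ k" using k assms by simp
  ultimately show ?thesis by simp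
qed

lemma Phi_eq: "sm t \<Longrightarrow> Phi w t = ereal (gf w t)"
  by (simp add: Phi_def gf_def suminf_ereal')

lemma Phi_infinite: "0 \<le> t \<Longrightarrow> \<not> sm t \<Longrightarrow> Phi w t = \<infinity>"
  using summable_ereal[of "\<lambda>k. w k * t ^ k"] nn by (auto simp: Phi_def)

lemma sm1_iff: assumes "0 < t" shows "summable (\<lambda>k. real k * w k * t ^ (k - 1)) \<longleftrightarrow> sm1 t"
proof -
  have e: "real k * w k * t ^ k = t * (real k * w k * t ^ (k - 1))" for k
    by (cases k) simp_all
  show ?thesis unfolding e using assms by (simp add: summable_cmult_iff)
qed

lemma Psi_eq: assumes "0 < t" "sm1 t" shows "Psi w t = ereal (gf1 w t / gf w t)"
proof -
  have s: "summable (\<lambda>k. real k * w k * t ^ (k - 1))" using sm1_iff assms by simp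
  have e: "real k * w k * t ^ k = t * (real k * w k * t ^ (k - 1))" for k
    by (cases k) simp_all
  have "gf1 w t = t * (\<Sum>k. real k * w k * t ^ (k - 1))"
    unfolding gf1_def e by (rule suminf_mult[OF s])
  moreover have "Phi' w t = ereal (\<Sum>k. real k * w k * t ^ (k - 1))"
    using s by (simp add: Phi'_def suminf_ereal')
  moreover have "gf w t \<noteq> 0" using gf_pos[of t] sm1_imp_sm[of t] assms by simp
  ultimately show ?thesis using Phi_eq[of t] sm1_imp_sm[of t] assms by (simp add: Psi_def)
qed

text \<open>This can happen only at the radius of convergence, where the series may converge while
  its derivative diverges.\<close>

lemma Psi_infinite: assumes "0 < t" "sm t" "\<not> sm1 t" shows "Psi w t = \<infinity>"
proof -
  have "Phi' w t = \<infinity>"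
    using summable_ereal[of "\<lambda>k. real k * w k * t ^ (k - 1)"] nn sm1_iff assms by (auto simp: Phi'_def)
  moreover have "0 < gf w t" using gf_pos assms by simp
  ultimately show ?thesis using assms by (simp add: Psi_def Phi_eq)
qed

lemma Psi_0: "Psi w 0 = 0"
  by (simp add: Psi_def zero_ereal_def[symmetric])

lemma PhiE_0: "PhiE w 0 = ereal (w 0)"
proof -
  have "sm 0" by (rule summable_finite[of "{0}"]) auto
  moreover have "gf w 0 = w 0" using powser_zero[of w] by (simp add: gf_def)
  ultimately show ?thesis by (simp add: PhiE_def Phi_eq)
qed

lemma PsiE_0: "PsiE w 0 = 0"
  by (simp add: PsiE_def PhiE_0 Psi_0)

lemma PsiE_below: assumes "0 < t" "ereal t < rho w" shows "PsiE w (ereal t) = ereal (gf1 w t / gf w t)"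
  using assms sm_below[of t] by (simp add: PsiE_def PhiE_def Phi_eq Psi_eq)

text \<open>\<open>(t \<Phi>'(t) - l \<Phi>(t)) t\<^sup>-\<^sup>l\<close> is a sum of terms each of which increases with \<open>t\<close>.\<close>
lemma gf1_minus_increasing:
  assumes st: "0 < s" "s < t" and sm1: "sm1 s" "sm1 t" and l: "0 < l" and s: "l * gf w s \<le> gf1 w s"
  shows "l * gf w t < gf1 w t"
proof -
  define y where "y = t / s"
  have y: "1 < y" and ty: "t = s * y" using st by (auto simp: y_def)
  have sm: "sm s" "sm t" using sm1 sm1_imp_sm st by auto
  \<comment> \<open>\<open>f\<close> compares the expression at \<open>t\<close> with
    \<open>y powr l\<close> times its value at \<open>s\<close>. Its terms are
    \<open>w k * s ^ k\<close> times a product of two factors of equal sign.\<close>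
  define f where "f = (\<lambda>k. (real k * w k * t ^ k - l * (w k * t ^ k))
      - y powr l * (real k * w k * s ^ k - l * (w k * s ^ k)))"
  have f: "f sums ((gf1 w t - l * gf w t) - y powr l * (gf1 w s - l * gf w s))"
    unfolding f_def gf1_def gf_def using sm sm1
    by (intro sums_diff sums_mult summable_sums)
  have f_eq: "f k = w k * s ^ k * ((real k - l) * (y powr real k - y powr l))" for k
    using y by (simp add: f_def ty power_mult_distrib powr_realpow algebra_simps)
  have f_nn: "0 \<le> f k" for k
  proof -
    have "0 \<le> (real k - l) * (y powr real k - y powr l)"
    proof (cases "l \<le> real k")
      case True
      then show ?thesis using y by (intro mult_nonneg_nonneg) auto
    next
      case False
      then show ?thesis using y by (intro mult_nonpos_nonpos) auto
    qed
    moreover have "0 \<le> w k * s ^ k" using nn st by simp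
    ultimately show ?thesis unfolding f_eq by (rule mult_nonneg_nonneg[rotated])
  qed
  \<comment> \<open>The term of index 0 makes the inequality strict.\<close>
  have "f 0 = w 0 * (l * (y powr l - 1))" using y by (simp add: f_eq algebra_simps)
  moreover have "1 < y powr l" using y l powr_less_mono[of 0 l y] by simp
  ultimately have "0 < f 0" using w0 l by simp
  then have "0 < suminf f" using suminf_pos_iff[of f] f f_nn sums_summable by blast
  then have "y powr l * (gf1 w s - l * gf w s) < gf1 w t - l * gf w t"
    using sums_unique[OF f] by simp
  moreover have "0 \<le> y powr l * (gf1 w s - l * gf w s)" using s by simp
  ultimately show ?thesis by linarith
qed

text \<open>In the variable \<open>ln t\<close> the right side is convex, and the left side is its
  tangent at \<open>s\<close>. Termwise this is \<open>1 + u \<le> exp u\<close>.\<close>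

lemma gf_tangent:
  assumes st: "0 < s" "0 < t" and sm: "sm1 s" "sm t"
  shows "s powr - l * (gf w s + ln (t / s) * (gf1 w s - l * gf w s)) \<le> gf w t * t powr - l"
proof -
  have sms: "sm s" using sm sm1_imp_sm st by auto
  have pw: "x ^ k * x powr - l = exp ((real k - l) * ln x)" if "0 < x" for x :: real and k :: nat
    using that by (simp add: powr_def powr_realpow[symmetric] exp_add[symmetric] algebra_simps)
  have 1: "(\<lambda>k. s powr - l * (w k * s ^ k + ln (t / s) * (real k * w k * s ^ k - l * (w k * s ^ k))))
      sums (s powr - l * (gf w s + ln (t / s) * (gf1 w s - l * gf w s)))"
    unfolding gf1_def gf_def using sm sms
    by (intro sums_add sums_diff sums_mult summable_sums)
  have 2: "(\<lambda>k. w k * t ^ k * t powr - l) sums (gf w t * t powr - l)"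
    unfolding gf_def using sm by (intro sums_mult2 summable_sums)
  show ?thesis
  proof (rule sums_le[OF _ 1 2])
    fix k
    have "s powr - l * (w k * s ^ k + ln (t / s) * (real k * w k * s ^ k - l * (w k * s ^ k)))
        = w k * ((s ^ k * s powr - l) * (1 + (real k - l) * ln (t / s)))"
      by (simp add: algebra_simps)
    also have "\<dots> \<le> w k * ((s ^ k * s powr - l) * exp ((real k - l) * ln (t / s)))"
      using nn st by (intro mult_left_mono exp_ge_add_one_self) auto
    also have "(s ^ k * s powr - l) * exp ((real k - l) * ln (t / s)) = t ^ k * t powr - l"
      using st by (simp add: pw exp_add[symmetric] ln_div algebra_simps)
    finally show "s powr - l * (w k * s ^ k + ln (t / s) * (real k * w k * s ^ k - l * (w k * s ^ k)))
        \<le> w k * t ^ k * t powr - l" by (simp add: mult.assoc)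
  qed
qed

section \<open>Monotonicity of \<Psi> up to the boundary\<close>

lemma Psi_less:
  assumes "0 < s" "s < t" "sm1 s" "sm1 t"
  shows "gf1 w s / gf w s < gf1 w t / gf w t"
proof -
  have g: "0 < gf w s" "0 < gf w t" using gf_pos sm1_imp_sm assms by auto
  have "0 < gf1 w s / gf w s" using g gf1_pos assms by simp
  \<comment> \<open>The level \<open>l\<close> is taken as the value of \<Psi> at \<open>s\<close>,
    where the hypothesis of \<open>gf1_minus_increasing\<close> is an equality.\<close>
  then have "gf1 w s / gf w s * gf w t < gf1 w t"
    using g assms by (intro gf1_minus_increasing[of s t]) auto
  then show ?thesis using g by (simp add: pos_less_divide_eq)
qed

text \<open>By monotonicity \<Psi> converges to its supremum below the radius, so \<open>Lim\<close>
  denotes a genuine limit. The filter is general in order to cover both \<open>at_top\<close> and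
  \<open>at_left\<close>.\<close>

lemma Lim_Psi_ge:
  assumes F: "F \<noteq> bot" and ev: "\<And>s. 0 < s \<Longrightarrow> ereal s < rho w \<Longrightarrow> eventually (\<lambda>t. s < t \<and> ereal t < rho w) F"
    and t: "0 < t" "ereal t < rho w"
  shows "Psi w t \<le> Lim F (Psi w)"
proof -
  define S where "S = {t. 0 < t \<and> ereal t < rho w}"
  have mono: "Psi w s \<le> Psi w t" if "s \<in> S" "t \<in> S" "s < t" for s t
    using that Psi_less[of s t] sm_below by (auto simp: S_def Psi_eq)
  have "(Psi w \<longlongrightarrow> (SUP s\<in>S. Psi w s)) F"
  proof (rule order_tendstoI)
    fix a assume "a < (SUP s\<in>S. Psi w s)"
    then obtain s where s: "s \<in> S" "a < Psi w s" by (auto simp: less_SUP_iff)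
    then have "eventually (\<lambda>t. s < t \<and> ereal t < rho w) F" by (intro ev) (auto simp: S_def)
    then show "eventually (\<lambda>t. a < Psi w t) F"
    proof eventually_elim
      case (elim t)
      then have "t \<in> S" using s by (auto simp: S_def)
      then show ?case using mono[of s t] s elim less_le_trans by blast
    qed
  next
    fix a assume a: "(SUP s\<in>S. Psi w s) < a"
    have "eventually (\<lambda>s. t < s \<and> ereal s < rho w) F" using t by (rule ev)
    then show "eventually (\<lambda>t. Psi w t < a) F"
    proof eventually_elim
      case (elim s)
      then have "s \<in> S" using t by (auto simp: S_def)
      then show ?case using a le_less_trans[OF SUP_upper] by metis
    qed
  qed
  then have "Lim F (Psi w) = (SUP s\<in>S. Psi w s)" using F by (intro tendsto_Lim) auto
  then show ?thesis using t by (auto simp: S_def intro: SUP_upper)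
qed

text \<open>Strictness ensures that a level reached inside the disc is not attained again at the
  boundary.\<close>

lemma PsiE_rho_greater:
  assumes t: "0 < t" "ereal t < rho w"
  shows "ereal (gf1 w t / gf w t) < PsiE w (rho w)"
proof -
  \<comment> \<open>A limit yields only a non-strict bound; strictness comes from this intermediate
    point.\<close>
  obtain t2 where t2: "ereal t < ereal t2" "ereal t2 < rho w" using ereal_dense2[OF t(2)] by blast
  have "ereal (gf1 w t / gf w t) < ereal (gf1 w t2 / gf w t2)"
    using Psi_less[of t t2] t t2 sm_below by simp
  also have "\<dots> = Psi w t2" using Psi_eq[of t2] t t2 sm_below[of t2] by simp
  finally have lt: "ereal (gf1 w t / gf w t) < Psi w t2" .
  show ?thesis
  proof (cases "PhiE w (rho w) < \<infinity>")
    case True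
    then obtain r where r: "rho w = ereal r" using t by (cases "rho w") (auto simp: PhiE_def)
    have r0: "0 < r" "t < r" using t r by auto
    have "sm r" using True r0 Phi_infinite[of r] by (auto simp: PhiE_def r)
    show ?thesis
    proof (cases "sm1 r")
      case True
      then show ?thesis
        using Psi_less[of t r] r0 t sm_below[of t] Psi_eq[of r] \<open>PhiE w (rho w) < \<infinity>\<close>
        by (simp add: PsiE_def r)
    next
      case False
      then show ?thesis
        using Psi_infinite[of r] r0 \<open>sm r\<close> \<open>PhiE w (rho w) < \<infinity>\<close> by (simp add: PsiE_def r)
    qed
  next
    case False
    have "Psi w t2 \<le> PsiE w (rho w)"
    proof (cases "rho w = \<infinity>")
      case True
      have "Psi w t2 \<le> Lim at_top (Psi w)"
        using t t2 by (intro Lim_Psi_ge) (auto simp: True eventually_gt_at_top)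
      then show ?thesis by (simp add: PsiE_def PhiE_def True)
    next
      case fin: False
      then obtain r where r: "rho w = ereal r" using t by (cases "rho w") auto
      have "Psi w t2 \<le> Lim (at_left r) (Psi w)"
      proof (rule Lim_Psi_ge)
        show "eventually (\<lambda>t. s < t \<and> ereal t < rho w) (at_left r)" if "0 < s" "ereal s < rho w" for s
          using that eventually_at_left_real[of s r] by (auto simp: r elim: eventually_mono)
      qed (use t t2 in auto)
      then show ?thesis using False by (simp add: PsiE_def r)
    qed
    with lt show ?thesis by (rule less_le_trans)
  qed
qed

lemma PsiE_pos:
  assumes "0 < t" "t \<le> rho w" shows "0 < PsiE w t"
proof (cases "t = rho w")
  case True
  obtain s where s: "ereal 0 < ereal s" "ereal s < rho w"
    using ereal_dense2[of "ereal 0" "rho w"] assms True by (auto simp: zero_ereal_def)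
  have "0 < gf1 w s / gf w s" using gf_pos gf1_pos sm_below[of s] s by simp
  then have "0 < ereal (gf1 w s / gf w s)" by simp
  also have "\<dots> < PsiE w (rho w)" using s by (intro PsiE_rho_greater) auto
  finally show ?thesis using True by simp
next
  case False
  then obtain s where s: "t = ereal s" "0 < s" "ereal s < rho w"
    using assms by (cases t) (auto simp: less_le)
  then show ?thesis using PsiE_below[of s] gf_pos gf1_pos sm_below[of s] by simp
qed

lemma rho_nonneg: "0 \<le> rho w"
  by (simp add: rho_def conv_radius_nonneg)

section \<open>Identification of \<tau>\<close>

lemma tau_0: "tau w 0 = 0"
proof -
  have "0 \<le> nu w"
    using PsiE_pos[of "rho w"] PsiE_0 rho_nonneg by (cases "rho w = 0") (auto simp: nu_def less_le)
  moreover have "(THE t. 0 \<le> t \<and> t \<le> rho w \<and> PsiE w t = ereal 0) = 0"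
  proof (rule the_equality)
    show "0 \<le> (0::ereal) \<and> 0 \<le> rho w \<and> PsiE w 0 = ereal 0"
      using rho_nonneg PsiE_0 by (simp add: zero_ereal_def)
    fix t assume t: "0 \<le> t \<and> t \<le> rho w \<and> PsiE w t = ereal 0"
    show "t = 0"
    proof (rule ccontr)
      assume "t \<noteq> 0"
      then have "0 < PsiE w t" using t by (intro PsiE_pos) auto
      then show False using t by simp
    qed
  qed
  ultimately show ?thesis by (simp add: tau_def zero_ereal_def)
qed

lemma tau_rho_0: assumes "rho w = 0" "0 < l" shows "tau w l = 0"
  using assms PsiE_0 by (simp add: tau_def nu_def zero_ereal_def)

text \<open>\<Psi> reaches \<open>l\<close> inside the disc: the intermediate value theorem gives a
  solution, and strict monotonicity up to the boundary gives the uniqueness that \<open>THE\<close>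
  requires.\<close>

lemma tau_critical:
  assumes l: "0 < l" and t0: "0 < t0" "ereal t0 < rho w" "l * gf w t0 \<le> gf1 w t0"
  obtains T where "0 < T" "tau w l = ereal T" "sm1 T" "gf1 w T = l * gf w T"
proof -
  obtain K where K: "ereal t0 < ereal K" "ereal K < rho w" using ereal_dense2[OF t0(2)] by blast
  have smK: "sm K" "sm1 K" using sm_below[of K] K t0 by auto
  have cont: "continuous_on {0..t0} (\<lambda>t. gf1 w t - l * gf w t)"
    unfolding gf_def gf1_def
    by (intro continuous_at_imp_continuous_on ballI continuous_intros
        Transcendental.isCont_powser[OF smK(1)] Transcendental.isCont_powser[OF smK(2)])
      (use K t0 in auto)
  have "gf1 w 0 - l * gf w 0 = - l * w 0"
    using powser_zero[of w] powser_zero[of "\<lambda>k. real k * w k"] by (simp add: gf_def gf1_def)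
  then have neg0: "gf1 w 0 - l * gf w 0 < 0" using w0 l by simp
  obtain T where T: "0 \<le> T" "T \<le> t0" "gf1 w T - l * gf w T = 0"
    using IVT'[of "\<lambda>t. gf1 w t - l * gf w t" 0 0 t0] neg0 t0 cont by auto
  have T0: "0 < T" using T neg0 by (cases "T = 0") auto
  have Tr: "ereal T < rho w" using T t0 by (metis ereal_less_eq(3) le_less_trans)
  have sT: "sm1 T" "0 < gf w T" using sm_below[of T] T0 Tr gf_pos by auto
  have eq: "gf1 w T / gf w T = l" using T sT by (simp add: field_simps)
  have nu: "ereal l < PsiE w (rho w)" using PsiE_rho_greater[OF T0 Tr] eq by simp
  have "(THE t. 0 \<le> t \<and> t \<le> rho w \<and> PsiE w t = ereal l) = ereal T"
  proof (rule the_equality)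
    show "0 \<le> ereal T \<and> ereal T \<le> rho w \<and> PsiE w (ereal T) = ereal l"
      using T0 Tr PsiE_below eq by simp
    fix t assume t: "0 \<le> t \<and> t \<le> rho w \<and> PsiE w t = ereal l"
    have "t \<noteq> rho w" using t nu by auto
    then have "t < rho w" using t by (simp add: less_le)
    moreover have "t \<noteq> 0" using t PsiE_0 l by (auto simp: zero_ereal_def)
    ultimately obtain s where s: "t = ereal s" "0 < s" "ereal s < rho w"
      using t by (cases t) (auto simp: less_le)
    have ls: "gf1 w s / gf w s = l" using PsiE_below[of s] s t by simp
    have "s = T"
      using Psi_less[of s T] Psi_less[of T s] s T0 sT(1) sm_below[of s] ls eq by fastforce
    then show "t = ereal T" using s by simp
  qed
  then have "tau w l = ereal T" using less_imp_le[OF nu] by (simp add: tau_def nu_def)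
  then show thesis using that T0 sT T by simp
qed

text \<open>\<Psi> stays below \<open>l\<close> inside the disc. The radius is then finite, since
  otherwise the term of index \<open>b\<close> would dominate for large \<open>t\<close>. Letting
  \<open>t\<close> increase to the radius bounds the partial sums there, so both series converge and
  \<Psi> is at most \<open>l\<close>.\<close>

lemma tau_boundary:
  assumes l: "0 < l" "l < real b" and wb: "0 < w b" and rho: "0 < rho w"
    and sub: "\<And>t. 0 < t \<Longrightarrow> ereal t < rho w \<Longrightarrow> gf1 w t < l * gf w t"
  obtains r where "0 < r" "rho w = ereal r" "tau w l = ereal r" "sm1 r" "gf1 w r \<le> l * gf w r"
proof -
  \<comment> \<open>The omitted terms have index above \<open>l\<close> and are nonnegative.\<close>
  have part: "(\<Sum>k<J. (real k - l) * w k * t ^ k) < 0" if "0 < t" "ereal t < rho w" "b < J" for t J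
  proof -
    have "(\<lambda>k. real k * w k * t ^ k - l * (w k * t ^ k)) sums (gf1 w t - l * gf w t)"
      unfolding gf1_def gf_def using sm_below[of t] that
      by (intro sums_diff sums_mult summable_sums) auto
    then have s: "(\<lambda>k. (real k - l) * w k * t ^ k) sums (gf1 w t - l * gf w t)"
      by (simp add: algebra_simps)
    have "(\<Sum>k<J. (real k - l) * w k * t ^ k) \<le> (\<Sum>k. (real k - l) * w k * t ^ k)"
      using that l nn by (intro sum_le_suminf sums_summable[OF s]) auto
    also have "\<dots> = gf1 w t - l * gf w t" using sums_unique[OF s] by simp
    finally show ?thesis using sub[of t] that by simp
  qed
  have b: "0 < b" using l by (cases b) auto
  have "rho w \<noteq> \<infinity>"
  proof
    assume inf: "rho w = \<infinity>"
    define S where "S = (\<Sum>k<b. w k)"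
    have S: "0 \<le> S" by (simp add: S_def sum_nonneg nn)
    \<comment> \<open>At this \<open>t \<ge> 1\<close> the term of index \<open>b\<close> outweighs
      the negative parts of all lower terms, against \<open>part\<close>.\<close>
    define t where "t = 1 + l * S / ((real b - l) * w b)"
    have t: "1 \<le> t" using S l wb by (simp add: t_def)
    have "0 < (real b - l) * w b" using l wb by simp
    then have "l * S \<le> (real b - l) * w b * t" using l wb by (simp add: t_def distrib_left)
    have "(\<Sum>k<b. - l * w k * t ^ (b - 1)) \<le> (\<Sum>k<b. (real k - l) * w k * t ^ k)"
    proof (rule sum_mono)
      fix k assume k: "k \<in> {..<b}"
      have "t ^ k \<le> t ^ (b - 1)" using k t by (intro power_increasing) auto
      then have "l * w k * t ^ k \<le> l * w k * t ^ (b - 1)" using l nn by (intro mult_left_mono) auto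
      moreover have "0 \<le> real k * w k * t ^ k" using nn t by simp
      ultimately show "- l * w k * t ^ (b - 1) \<le> (real k - l) * w k * t ^ k"
        by (simp add: algebra_simps)
    qed
    moreover have "(\<Sum>k<b. - l * w k * t ^ (b - 1)) = - (l * S) * t ^ (b - 1)"
      by (simp add: S_def sum_distrib_left sum_distrib_right sum_negf)
    moreover have "(\<Sum>k<Suc b. (real k - l) * w k * t ^ k) < 0"
      using t inf by (intro part) auto
    moreover have "(real b - l) * w b * t ^ b = (real b - l) * w b * t * t ^ (b - 1)"
      using b by (cases b) simp_all
    moreover have "l * S * t ^ (b - 1) \<le> (real b - l) * w b * t * t ^ (b - 1)"
      using \<open>l * S \<le> _\<close> t by (intro mult_right_mono) auto
    ultimately show False by simp
  qed
  then obtain r where r: "rho w = ereal r" "0 < r" using rho by (cases "rho w") auto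
  define f where "f = (\<lambda>k. (real k - l) * w k * r ^ k)"
  have f_part: "(\<Sum>k<J. f k) \<le> 0" if "b < J" for J
  proof (rule tendsto_upperbound)
    show "((\<lambda>t. \<Sum>k<J. (real k - l) * w k * t ^ k) \<longlongrightarrow> (\<Sum>k<J. f k)) (at_left r)"
      unfolding f_def by (intro tendsto_intros)
    show "eventually (\<lambda>t. (\<Sum>k<J. (real k - l) * w k * t ^ k) \<le> 0) (at_left r)"
      using eventually_at_left_real[OF r(2)]
      by eventually_elim (use part that r in \<open>auto intro: less_imp_le\<close>)
  qed simp
  have f_nn: "0 \<le> f k" if "b \<le> k" for k
    using that l nn r unfolding f_def by (intro mult_nonneg_nonneg) auto
  have "summable (\<lambda>k. f (k + b))"
  proof (rule summableI_nonneg_bounded)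
    show "0 \<le> f (k + b)" for k by (rule f_nn) simp
    show "(\<Sum>k<n. f (k + b)) \<le> - (\<Sum>k<b. f k)" for n
    proof -
      have "(\<Sum>k<n. f (k + b)) \<le> (\<Sum>k<Suc n. f (k + b))" using f_nn by simp
      moreover have "(\<Sum>k<Suc n + b. f k) = (\<Sum>k<b. f k) + (\<Sum>k<Suc n. f (k + b))"
        by (induction n) (simp_all add: add_ac)
      ultimately show ?thesis using f_part[of "Suc n + b"] by simp
    qed
  qed
  then have sf: "summable f" by (simp add: summable_iff_shift)
  \<comment> \<open>For \<open>k \<ge> b\<close> the factor \<open>k - l\<close> is at least
    \<open>b - l > 0\<close>, so summability of \<open>f\<close> passes to the series itself and
    then to its derivative.\<close>
  have smr: "sm r"
  proof (rule summable_comparison_test'[OF summable_divide[OF sf, of "real b - l"], of b])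
    fix k assume "b \<le> k"
    then have "(real b - l) * (w k * r ^ k) \<le> (real k - l) * (w k * r ^ k)"
      using nn r by (intro mult_right_mono) auto
    then show "norm (w k * r ^ k) \<le> f k / (real b - l)"
      using l nn r by (simp add: f_def field_simps)
  qed
  have "summable (\<lambda>k. f k + l * (w k * r ^ k))" using sf smr by (intro summable_add summable_mult)
  then have sm1r: "sm1 r" by (simp add: f_def algebra_simps)
  have fs: "f sums (gf1 w r - l * gf w r)"
  proof -
    have "(\<lambda>k. real k * w k * r ^ k - l * (w k * r ^ k)) sums (gf1 w r - l * gf w r)"
      unfolding gf1_def gf_def using smr sm1r by (intro sums_diff sums_mult summable_sums)
    then show ?thesis by (simp add: f_def algebra_simps)
  qed
  have "gf1 w r - l * gf w r \<le> 0"
    using LIMSEQ_le_const2[OF fs[unfolded sums_def], of 0] f_part by (metis Suc_le_eq)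
  then have le: "gf1 w r \<le> l * gf w r" by simp
  have g: "0 < gf w r" using gf_pos smr r by simp
  have PsiEr: "PsiE w (ereal r) = ereal (gf1 w r / gf w r)"
    using smr sm1r r by (simp add: PsiE_def PhiE_def Phi_eq Psi_eq)
  have "tau w l = ereal r"
  \<comment> \<open>If \<open>l\<close> is at most \<open>nu w\<close>, then \<Psi> equals
    \<open>l\<close> at the radius and \<open>THE\<close> picks it; otherwise \<tau> is the radius
    by definition.\<close>
  proof (cases "ereal l \<le> nu w")
    case True
    then have eq: "gf1 w r / gf w r = l"
      using PsiEr le g by (simp add: nu_def r field_simps)
    have "(THE t. 0 \<le> t \<and> t \<le> rho w \<and> PsiE w t = ereal l) = ereal r"
    proof (rule the_equality)
      show "0 \<le> ereal r \<and> ereal r \<le> rho w \<and> PsiE w (ereal r) = ereal l" using r PsiEr eq by simp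
      fix t assume t: "0 \<le> t \<and> t \<le> rho w \<and> PsiE w t = ereal l"
      show "t = ereal r"
      proof (rule ccontr)
        assume "t \<noteq> ereal r"
        then have "t < rho w" using t r by (simp add: less_le)
        moreover have "t \<noteq> 0" using t PsiE_0 l by (auto simp: zero_ereal_def)
        ultimately obtain s where s: "t = ereal s" "0 < s" "ereal s < rho w"
          using t by (cases t) (auto simp: less_le)
        then have "gf1 w s / gf w s = l" using PsiE_below[of s] t by simp
        moreover have "0 < gf w s" using gf_pos sm_below s by simp
        ultimately show False using sub[of s] s by (simp add: field_simps)
      qed
    qed
    then show ?thesis using True by (simp add: tau_def)
  next
    case False
    then show ?thesis by (simp add: tau_def r)
  qed
  then show thesis using that r sm1r le by blast
qed

text \<open>By \<open>gf_tangent\<close>: in the critical case the tangent at \<open>T\<close> is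
  horizontal. In the boundary case its slope is at most 0 and no admissible \<open>t\<close> lies
  beyond the radius, so the tangent stays above the boundary value.\<close>

lemma tau_minimizes:
  assumes l: "0 < l" "l < real b" and wb: "0 < w b" and rho: "0 < rho w"
  obtains T where "0 < T" "tau w l = ereal T" "sm T"
    "\<And>t. 0 < t \<Longrightarrow> sm t \<Longrightarrow> gf w T * T powr - l \<le> gf w t * t powr - l"
proof (cases "\<exists>t. 0 < t \<and> ereal t < rho w \<and> l * gf w t \<le> gf1 w t")
  case True
  then obtain t0 where "0 < t0" "ereal t0 < rho w" "l * gf w t0 \<le> gf1 w t0" by blast
  from tau_critical[OF l(1) this] obtain T where
    T: "0 < T" "tau w l = ereal T" "sm1 T" "gf1 w T = l * gf w T" .
  show thesis
  proof (rule that[OF T(1,2)])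
    show "sm T" using sm1_imp_sm T by simp
    show "gf w T * T powr - l \<le> gf w t * t powr - l" if "0 < t" "sm t" for t
      using gf_tangent[of T t l] T that by (simp add: mult.commute)
  qed
next
  case False
  then have "\<And>t. 0 < t \<Longrightarrow> ereal t < rho w \<Longrightarrow> gf1 w t < l * gf w t" by force
  from tau_boundary[OF l wb rho this] obtain r where
    r: "0 < r" "rho w = ereal r" "tau w l = ereal r" "sm1 r" "gf1 w r \<le> l * gf w r" .
  show thesis
  proof (rule that[OF r(1,3)])
    show "sm r" using sm1_imp_sm r by simp
    fix t assume t: "0 < t" "sm t"
    have "t \<le> r" using sm_imp_le_rho[of t] t r by simp
    then have "ln (t / r) \<le> 0" using t r by simp
    then have "0 \<le> ln (t / r) * (gf1 w r - l * gf w r)" using r by (intro mult_nonpos_nonpos) auto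
    then have "gf w r * r powr - l \<le> r powr - l * (gf w r + ln (t / r) * (gf1 w r - l * gf w r))"
      using r by (simp add: mult.commute mult_left_mono)
    also have "\<dots> \<le> gf w t * t powr - l" using r t by (intro gf_tangent) auto
    finally show "gf w r * r powr - l \<le> gf w t * t powr - l" .
  qed
qed

end

theorem theorem17p9:
  fixes w :: "nat \<Rightarrow> real" and m :: "nat \<Rightarrow> nat" and l :: real
  assumes nonneg: "\<And>k. 0 \<le> w k"
    and w0: "0 < w 0"
    and wk: "\<exists>k\<ge>1. 0 < w k"
    and l_nonneg: "0 \<le> l"
    and l_less: "ereal l < omega w"
    and mn: "(\<lambda>n. real (m n) / real n) \<longlonglongrightarrow> l"
  shows "((\<lambda>n. ereal (Z w (m n) (Suc n) / Z w (m n) n)) \<longlongrightarrow> PhiE w (tau w l))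
           (inf sequentially (principal {n. 0 < Z w (m n) n}))"
proof -
  interpret weight_sequence w using nonneg w0 wk by unfold_locales
  \<comment> \<open>In the first two cases \<tau> is 0, so the limit is \<open>w 0\<close>; only the
    third has a minimiser in the open half-line.\<close>
  consider "l = 0" | "0 < l" "rho w = 0" | "0 < l" "0 < rho w"
    using l_nonneg rho_nonneg by fastforce
  then show ?thesis
  proof cases
    case 1
    then show ?thesis
      using Z_ratio_tendsto_zero_density[of w m] nonneg w0 mn by (simp add: tau_0 PhiE_0 tendsto_ereal)
  next
    case 2
    then show ?thesis
      using Z_ratio_tendsto_zero_radius[of w l m] nonneg w0 mn
      by (simp add: tau_rho_0 PhiE_0 tendsto_ereal rho_def)
  next
    case 3
    \<comment> \<open>\<open>l < omega w\<close> supplies a positive weight beyond \<open>l\<close>,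
      which confines the minimisation on the right.\<close>
    obtain b where b: "0 < w b" "l < real b"
      using l_less by (auto simp: omega_def less_Sup_iff)
    obtain T where T: "0 < T" "tau w l = ereal T" "summable (\<lambda>k. w k * T ^ k)"
      "\<And>t. 0 < t \<Longrightarrow> summable (\<lambda>k. w k * t ^ k) \<Longrightarrow> gf w T * T powr - l \<le> gf w t * t powr - l"
      using tau_minimizes[OF 3(1) b(2,1) 3(2)] by blast
    have "((\<lambda>n. Z w (m n) (Suc n) / Z w (m n) n) \<longlongrightarrow> gf w T)
           (inf sequentially (principal {n. 0 < Z w (m n) n}))"
      unfolding gf_def
      by (rule Z_ratio_tendsto_minimum[OF nonneg w0 b(1) 3(1) b(2) T(1,3) _ mn])
        (use T(4) in \<open>simp add: gf_def\<close>)
    then show ?thesis using T by (simp add: PhiE_def Phi_eq tendsto_ereal)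
  qed
qed

end
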